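(* Let $\mathbb{Q}\subseteq k\subseteq l$ with $l/\mathbb{Q}$ and $k/\mathbb{Q}$ finite Galois and $1\le r(k)<r(l)$; let $G=\mathrm{Aut}(l/\mathbb{Q})$, $H=\mathrm{Aut}(l/k)$, $\widehat w$ an archimedean place of $l$, $\Psi$ a transversal for the left cosets of $G_{\widehat w}$ in $G$, and $\Delta$ as in the context. Let $I=[G:G_{\widehat w}H]$, $J=[G_{\widehat w}H:G_{\widehat w}]$, let $\{\tau_1,\dots,\tau_I\}$ be a transversal for the left cosets of $G_{\widehat w}H$ in $G$ and $\{\sigma_1,\dots,\sigma_J\}$ a transversal for the left cosets of $G_{\widehat w}$ in $G_{\widehat w}H$, and for each $i$ let $\mathcal J_i\subseteq\{1,\dots,J\}$ have cardinality $J-1$. Define $\lambda:G\to\mathbb{Z}$ by $\lambda(g)=J-1$ if $g\in G_{\widehat w}$, $\lambda(g)=-1$ if $g\in G_{\widehat w}H\setminus G_{\widehat w}$, and $\lambda(g)=0$ otherwise. Let $\beta\in F_l$ be a special Minkowski unit with respect to $\widehat w$. (i) If $l/\mathbb{Q}$ is totally real, the elements $\tau_i\sigma_j(\Delta(\beta,\lambda))$, $i=1,\dots,I$, $j\in\mathcal J_i$, are multiplicatively independent relative units in $E_{l/k}$, and $h(\Delta(\beta,\lambda))\le2([l:k]-1)h(\beta)$. (ii) If $l/\mathbb{Q}$ is totally complex, with $G_{\widehat w}=\{1,\rho\}$, $\rho^2=1$, the elements $\tau_i\sigma_j(\Delta(\beta\rho(\beta),\lambda))$, $i=1,\dots,I$,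 $j\in\mathcal J_i$, are multiplicatively independent relative units in $E_{l/k}$, and $h(\Delta(\beta\rho(\beta),\lambda))\le4([l:k]-1)h(\beta)$.
   Context: $F_l=O_l^\times/\mathrm{Tor}(O_l^\times)$, free abelian of rank $r(l)$, with $G$ acting on it. For a place $w$ of $l$, $\|\cdot\|_w$ extends the usual absolute value of $\mathbb{Q}$ and $|\cdot|_w=\|\cdot\|_w^{d_w/d}$, $d_w=[l_w:\mathbb{Q}_w]$, $d=[l:\mathbb{Q}]$; $h(\alpha)=\sum_w\log^+|\alpha|_w$ is the Weil height. For $\sigma\in G$, $\sigma w$ is the place with $\|\sigma^{-1}(\gamma)\|_w=\|\gamma\|_{\sigma w}$; $G_{\widehat w}=\{\sigma\in G:\sigma\widehat w=\widehat w\}$ (trivial if $l$ totally real, of order 2 if totally complex), and $N=[G:G_{\widehat w}]$. $\mathbb{Z}^N$ is the group of functions $f:G\to\mathbb{Z}$ constant on left cosets of $G_{\widehat w}$, and $\Delta(\alpha,f)=\prod_{n=1}^N\psi_n(\alpha)^{f(\psi_n)}$ for $\Psi=\{\psi_1,\dots,\psi_N\}$. $E_{l/k}$ is the kernel of the homomorphism $\mathrm{norm}_{l/k}:F_l\to F_k$ induced by the field norm (relative units). An element $\beta\in F_l$ is a special Minkowski unit with respect to $\widehat w$ if $\log|\beta|_w<0$ for every archimedean place $w\ne\widehat w$. *)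

theory Defs
  imports Complex_Main "HOL-Computational_Algebra.Polynomial"
begin

text \<open>Number fields are modelled as subfields of the complex numbers.
  Automorphisms are total functions on complex which restrict to a field
  automorphism of the field and are the identity outside it, so that
  the automorphism group is an honest set of functions with composition as
  group law.\<close>

type_synonym cauto = "complex \<Rightarrow> complex"

definition subfield_C :: "complex set \<Rightarrow> bool" where
  "subfield_C K \<longleftrightarrow> 0 \<in> K \<and> 1 \<in> K \<and>
     (\<forall>x\<in>K. \<forall>y\<in>K. x + y \<in> K \<and> x * y \<in> K \<and> x - y \<in> K) \<and>
     (\<forall>x\<in>K. x \<noteq> 0 \<longrightarrow> inverse x \<in> K)"

definition spans_over :: "complex set \<Rightarrow> complex set \<Rightarrow> complex set \<Rightarrow> bool" where
  "spans_over K B L \<longleftrightarrow>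
     (\<forall>x\<in>L. \<exists>c. (\<forall>b\<in>B. c b \<in> K) \<and> x = (\<Sum>b\<in>B. c b * b))"

definition fdeg :: "complex set \<Rightarrow> complex set \<Rightarrow> nat" where
  "fdeg K L = (LEAST n. \<exists>B. finite B \<and> B \<subseteq> L \<and> card B = n \<and> spans_over K B L)"

definition number_field :: "complex set \<Rightarrow> bool" where
  "number_field L \<longleftrightarrow> subfield_C L \<and>
     (\<exists>B. finite B \<and> B \<subseteq> L \<and> spans_over \<rat> B L)"

text \<open>Galois over Q (normal; separability is automatic in characteristic 0):
  every element is a root of a nonzero rational polynomial all of whose
  complex roots lie in the field.\<close>
definition galois_over_Q :: "complex set \<Rightarrow> bool" where
  "galois_over_Q L \<longleftrightarrow> number_field L \<and>
     (\<forall>x\<in>L. \<exists>p :: complex poly. p \<noteq> 0 \<and> (\<forall>i. coeff p i \<in> \<rat>) \<and> poly p x = 0 \<and>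
        (\<forall>z. poly p z = 0 \<longrightarrow> z \<in> L))"

definition aut :: "complex set \<Rightarrow> complex set \<Rightarrow> cauto set" where
  "aut L K = {\<sigma>. bij_betw \<sigma> L L \<and>
      (\<forall>x\<in>L. \<forall>y\<in>L. \<sigma> (x + y) = \<sigma> x + \<sigma> y \<and> \<sigma> (x * y) = \<sigma> x * \<sigma> y) \<and>
      (\<forall>x\<in>K. \<sigma> x = x) \<and> (\<forall>x. x \<notin> L \<longrightarrow> \<sigma> x = x)}"

text \<open>Archimedean places of L (L Galois, so the embeddings are the
  automorphisms): a place w is represented by its absolute value
  norm_w x = cmod (sigma x); conjugate embeddings give the same function.\<close>
definition arch_places :: "complex set \<Rightarrow> (complex \<Rightarrow> real) set" where
  "arch_places L = {(\<lambda>x. cmod (\<sigma> x)) | \<sigma>. \<sigma> \<in> aut L \<rat>}"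

definition real_place :: "complex set \<Rightarrow> (complex \<Rightarrow> real) \<Rightarrow> bool" where
  "real_place L w \<longleftrightarrow> (\<exists>\<sigma>\<in>aut L \<rat>. w = (\<lambda>x. cmod (\<sigma> x)) \<and> \<sigma> ` L \<subseteq> \<real>)"

definition loc_deg :: "complex set \<Rightarrow> (complex \<Rightarrow> real) \<Rightarrow> nat" where
  "loc_deg L w = (if real_place L w then 1 else 2)"

text \<open>log |x|_w with |x|_w = norm_w(x)^(d_w/d).\<close>
definition log_abs :: "complex set \<Rightarrow> (complex \<Rightarrow> real) \<Rightarrow> complex \<Rightarrow> real" where
  "log_abs L w x = (real (loc_deg L w) / real (fdeg \<rat> L)) * ln (w x)"

definition place_act :: "cauto \<Rightarrow> (complex \<Rightarrow> real) \<Rightarrow> (complex \<Rightarrow> real)" where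
  "place_act \<sigma> w = (\<lambda>\<gamma>. w (inv \<sigma> \<gamma>))"

definition place_stab :: "complex set \<Rightarrow> (complex \<Rightarrow> real) \<Rightarrow> cauto set" where
  "place_stab L w = {\<sigma> \<in> aut L \<rat>. place_act \<sigma> w = w}"

definition totally_real :: "complex set \<Rightarrow> bool" where
  "totally_real L \<longleftrightarrow> (\<forall>\<sigma>\<in>aut L \<rat>. \<sigma> ` L \<subseteq> \<real>)"

definition totally_complex :: "complex set \<Rightarrow> bool" where
  "totally_complex L \<longleftrightarrow> (\<forall>\<sigma>\<in>aut L \<rat>. \<not> (\<sigma> ` L \<subseteq> \<real>))"

definition alg_integer :: "complex \<Rightarrow> bool" where
  "alg_integer x \<longleftrightarrow> (\<exists>p :: int poly. lead_coeff p = 1 \<and> poly (map_poly of_int p) x = 0)"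

definition units_of_int :: "complex set \<Rightarrow> complex set" where
  "units_of_int L = {x \<in> L. alg_integer x \<and> x \<noteq> 0 \<and> alg_integer (inverse x)}"

definition root_of_unity :: "complex \<Rightarrow> bool" where
  "root_of_unity x \<longleftrightarrow> (\<exists>n>0. x ^ n = 1)"

text \<open>Multiplicative independence in F_L = O_L^x / Tor of a family of units
  (given by representatives): no nontrivial integer relation modulo torsion.\<close>
definition mult_indep :: "'i set \<Rightarrow> ('i \<Rightarrow> complex) \<Rightarrow> bool" where
  "mult_indep P f \<longleftrightarrow>
     (\<forall>e :: 'i \<Rightarrow> int. root_of_unity (\<Prod>p\<in>P. f p powi e p) \<longrightarrow> (\<forall>p\<in>P. e p = 0))"

definition unit_rank :: "complex set \<Rightarrow> nat" where
  "unit_rank L = (GREATEST n. \<exists>U. finite U \<and> card U = n \<and> U \<subseteq> units_of_int L \<and> mult_indep U id)"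

text \<open>Relative norm and relative units E_{L/K} (classes in F_L whose norm is
  trivial in F_K, i.e. the norm of a representative is a root of unity).\<close>
definition rel_norm :: "complex set \<Rightarrow> complex set \<Rightarrow> complex \<Rightarrow> complex" where
  "rel_norm L K x = (\<Prod>\<sigma>\<in>aut L K. \<sigma> x)"

definition rel_unit :: "complex set \<Rightarrow> complex set \<Rightarrow> complex \<Rightarrow> bool" where
  "rel_unit L K x \<longleftrightarrow> x \<in> units_of_int L \<and> root_of_unity (rel_norm L K x)"

text \<open>Weil height, evaluated on units of L: the non-archimedean terms
  log^+ |x|_w vanish for units, so only archimedean places contribute.\<close>
definition unit_height :: "complex set \<Rightarrow> complex \<Rightarrow> real" where
  "unit_height L x = (\<Sum>w\<in>arch_places L. max 0 (log_abs L w x))"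

definition special_minkowski :: "complex set \<Rightarrow> (complex \<Rightarrow> real) \<Rightarrow> complex \<Rightarrow> bool" where
  "special_minkowski L w0 \<beta> \<longleftrightarrow> \<beta> \<in> units_of_int L \<and>
     (\<forall>w\<in>arch_places L. w \<noteq> w0 \<longrightarrow> log_abs L w \<beta> < 0)"

definition lcoset :: "cauto \<Rightarrow> cauto set \<Rightarrow> cauto set" where
  "lcoset g K = (\<lambda>h. g \<circ> h) ` K"

definition left_transversal :: "cauto set \<Rightarrow> cauto set \<Rightarrow> cauto set \<Rightarrow> bool" where
  "left_transversal G K T \<longleftrightarrow> T \<subseteq> G \<and> (\<forall>g\<in>G. \<exists>!t\<in>T. t \<in> lcoset g K)"

definition set_prod :: "cauto set \<Rightarrow> cauto set \<Rightarrow> cauto set" where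
  "set_prod A B = {a \<circ> b | a b. a \<in> A \<and> b \<in> B}"

definition Delta :: "cauto set \<Rightarrow> complex \<Rightarrow> (cauto \<Rightarrow> int) \<Rightarrow> complex" where
  "Delta Psi \<alpha> f = (\<Prod>\<psi>\<in>Psi. (\<psi> \<alpha>) powi (f \<psi>))"

end

theory Submission
  imports Defs "Jordan_Normal_Form.Char_Poly"
    "HOL-Computational_Algebra.Fundamental_Theorem_Algebra"
begin

text \<open>
  Put \<open>A(g) = log \<parallel>\<alpha>\<parallel>\<close> at the place \<open>g w\<^sub>0\<close>, where \<open>\<alpha>\<close> is \<open>\<beta>\<close> or \<open>\<beta> \<rho>(\<beta>)\<close>, a unit fixed by the
  stabiliser \<open>W\<close> of \<open>w\<^sub>0\<close>. Then \<open>A < 0\<close> off \<open>W\<close> and \<open>A\<close> sums to 0 over \<open>G\<close> by the product formula.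
  Taking logarithms, a multiplicative relation among the conjugates of \<open>\<Delta>(\<alpha>, \<lambda>)\<close> with exponent
  function \<open>f\<close> on \<open>G/W\<close> says that \<open>f * \<lambda>\<close> is killed by the matrix \<open>A(g\<inverse>h)\<close>. The maximum principle makes
  \<open>f * \<lambda>\<close> constant, hence 0 since \<open>\<lambda>\<close> has mean zero; thus \<open>f\<close> is constant on cosets of \<open>W H\<close>, and it
  vanishes somewhere on each of them because one index per coset is omitted. The relative norm of
  \<open>\<Delta>(\<alpha>, \<lambda>)\<close> is the norm of \<open>\<alpha>\<close> raised to the power \<open>\<Sum> \<lambda> = 0\<close>, and the height bound is subadditivity
  together with \<open>\<Sum> \<bar>\<lambda>\<bar> = 2(J - 1)\<close> and \<open>J \<le> card H \<le> [l : k]\<close>.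
\<close>

text \<open>The choice of \<lambda> explains itself through convolution: for f constant on left
  cosets of W, f * \<lambda> is \<open>card P\<close> times the difference between f and its average
  over cosets of P = W H, so its kernel consists of the functions constant on these cosets. Nothing
  is known about the sign of A on W itself; hence \<alpha> has to be fixed by W, so that all
  functions involved live on G/W and W is a single entry of the matrix. In the totally complex case
  this forces \<beta> \<rho>(\<beta>) and costs the extra factor 2 in the height. The arithmetic
  input is the product formula. The absolute norm of a unit is invariant under G, and it is 1 or -1
  once invariant elements are known to be rational and products of algebraic integers to be
  integral. The first fact is the reason for primitive elements and minimal polynomials over
  subfields of the complex numbers. Sums over places are replaced by sums over G, where each place
  is counted \<open>card W\<close> times: the product formula and the invariance of the height under
  G then become reindexings. That k is Galois over the rationals makes H normal in G, so that W H is
  a group and the relative norm commutes with G.\<close>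

unbundle no m_inv_syntax

section \<open>Products of algebraic integers\<close>

text \<open>An eigenvalue of an integer matrix is a root of its characteristic polynomial, which is
  monic with integer coefficients. The index \<open>i0\<close> guarantees that the eigenvector is
  nonzero.\<close>

lemma alg_integer_if_integer_eigenvalue:
  fixes v :: "'i \<Rightarrow> complex" and M :: "'i \<Rightarrow> 'i \<Rightarrow> int"
  assumes fin: "finite I" and nz: "i0 \<in> I" "v i0 \<noteq> 0"
    and eig: "\<And>i. i \<in> I \<Longrightarrow> z * v i = (\<Sum>j\<in>I. of_int (M i j) * v j)"
  shows "alg_integer z"
proof -
  define n where "n = card I"
  obtain b where b: "bij_betw b {0..<n} I"
    using ex_bij_betw_nat_finite[OF fin] n_def by blast
  define A :: "int mat" where "A = mat n n (\<lambda>(i, j). M (b i) (b j))"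
  define B :: "complex mat" where "B = map_mat of_int A"
  define u where "u = vec n (\<lambda>i. v (b i))"
  have A: "A \<in> carrier_mat n n" and B: "B \<in> carrier_mat n n"
    by (auto simp: A_def B_def)
  obtain k where k: "k < n" "b k = i0"
    using b nz(1) by (metis atLeastLessThan_iff bij_betw_iff_bijections)
  have "eigenvector B u z"
    unfolding eigenvector_def
  proof (intro conjI)
    show "u \<in> carrier_vec (dim_row B)"
      using B by (auto simp: u_def)
    show "u \<noteq> 0\<^sub>v (dim_row B)"
    proof
      assume "u = 0\<^sub>v (dim_row B)"
      then have "vec_index u k = vec_index (0\<^sub>v (dim_row B)) k"
        by simp
      then show False
        using k nz(2) B by (simp add: u_def)
    qed
    show "B *\<^sub>v u = z \<cdot>\<^sub>v u"
    proof (rule eq_vecI)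
      fix i assume "i < dim_vec (z \<cdot>\<^sub>v u)"
      then have i: "i < n"
        by (simp add: u_def)
      have "b i \<in> I"
        using b i by (auto simp: bij_betw_def)
      have "vec_index (B *\<^sub>v u) i = (\<Sum>j = 0..<n. of_int (M (b i) (b j)) * v (b j))"
        using i by (auto simp: B_def A_def u_def scalar_prod_def intro!: sum.cong)
      also have "\<dots> = (\<Sum>j\<in>I. of_int (M (b i) j) * v j)"
        by (rule sum.reindex_bij_betw[OF b])
      also have "\<dots> = z * v (b i)"
        using eig[OF \<open>b i \<in> I\<close>] by simp
      finally show "vec_index (B *\<^sub>v u) i = vec_index (z \<cdot>\<^sub>v u) i"
        using i by (simp add: u_def)
    qed (auto simp: u_def B_def A_def)
  qed
  then have "poly (char_poly B) z = 0"
    using eigenvalue_root_char_poly[OF B] by (auto simp: eigenvalue_def)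
  moreover have "char_poly B = map_poly of_int (char_poly A)"
    unfolding B_def by (rule of_int_hom.char_poly_hom[OF A])
  ultimately show ?thesis
    unfolding alg_integer_def using degree_monic_char_poly[OF A] by metis
qed

text \<open>Multiplication by x maps the integer span of the powers below \<open>degree p\<close> to
  itself; the equation of x is needed only for the top power, the others are merely shifted.\<close>

lemma monic_power_reduction:
  fixes x :: complex and p :: "int poly"
  assumes "lead_coeff p = 1" "poly (map_poly of_int p) x = 0" "i < degree p"
  shows "\<exists>c :: nat \<Rightarrow> int. x ^ Suc i = (\<Sum>a<degree p. of_int (c a) * x ^ a)"
proof (cases "Suc i = degree p")
  case True
  have "0 = (\<Sum>a\<le>degree p. of_int (coeff p a) * x ^ a)"
    using assms(2) by (simp add: poly_altdef)
  also have "{..degree p} = insert (degree p) {..<degree p}"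
    by auto
  finally have "x ^ degree p = (\<Sum>a<degree p. of_int (- coeff p a) * x ^ a)"
    using assms(1) by (simp add: sum_negf eq_neg_iff_add_eq_0)
  then show ?thesis
    using True by (intro exI[of _ "\<lambda>a. - coeff p a"]) metis
next
  case False
  then have "Suc i < degree p"
    using assms(3) by simp
  then have "x ^ Suc i = (\<Sum>a<degree p. of_int (if a = Suc i then 1 else 0) * x ^ a)"
    by (simp add: if_distrib[of of_int] if_distrib[of "\<lambda>t. t * _"] sum.delta cong: if_cong)
  then show ?thesis
    by (rule exI[of _ "\<lambda>a. if a = Suc i then 1 else 0"])
qed

text \<open>The monomials x^i y^j with i < \<open>degree p\<close> and j < \<open>degree q\<close>
  form an eigenvector for x y; the integer matrix is the tensor product of the matrices of
  multiplication by x and by y.\<close>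

lemma alg_integer_mult:
  assumes "alg_integer x" "alg_integer y"
  shows "alg_integer (x * y)"
proof -
  obtain p where p: "lead_coeff p = 1" "poly (map_poly of_int p) x = 0"
    using assms(1) by (auto simp: alg_integer_def)
  obtain q where q: "lead_coeff q = 1" "poly (map_poly of_int q) y = 0"
    using assms(2) by (auto simp: alg_integer_def)
  \<comment> \<open>A monic constant polynomial is 1 and has no root. Positive degrees put (0, 0)
    into the index set, where the eigenvector has the entry 1.\<close>
  have deg: "degree p > 0" "degree q > 0"
    using p q by (auto intro!: Nat.gr0I elim!: degree_eq_zeroE)
  obtain c where c: "\<And>i. i < degree p \<Longrightarrow> x ^ Suc i = (\<Sum>a<degree p. of_int (c i a :: int) * x ^ a)"
    using monic_power_reduction[OF p] by metis
  obtain d where d: "\<And>i. i < degree q \<Longrightarrow> y ^ Suc i = (\<Sum>a<degree q. of_int (d i a :: int) * y ^ a)"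
    using monic_power_reduction[OF q] by metis
  show ?thesis
  proof (rule alg_integer_if_integer_eigenvalue)
    show "finite ({..<degree p} \<times> {..<degree q})" "(0, 0) \<in> {..<degree p} \<times> {..<degree q}"
      using deg by auto
    show "(case (0, 0) of (i, j) \<Rightarrow> x ^ i * y ^ j) \<noteq> 0"
      by simp
    fix k assume "k \<in> {..<degree p} \<times> {..<degree q}"
    then obtain i j where k: "k = (i, j)" "i < degree p" "j < degree q"
      by auto
    have "x * y * (x ^ i * y ^ j) = x ^ Suc i * y ^ Suc j"
      by simp
    also have "\<dots> = (\<Sum>(a, b)\<in>{..<degree p} \<times> {..<degree q}.
        of_int (c i a) * x ^ a * (of_int (d j b) * y ^ b))"
      unfolding c[OF k(2)] d[OF k(3)] sum_product sum.cartesian_product ..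
    finally show "x * y * (case k of (i, j) \<Rightarrow> x ^ i * y ^ j) =
        (\<Sum>m\<in>{..<degree p} \<times> {..<degree q}.
          of_int (c (fst k) (fst m) * d (snd k) (snd m)) * (case m of (i, j) \<Rightarrow> x ^ i * y ^ j))"
      by (simp add: k case_prod_unfold mult_ac)
  qed
qed

section \<open>Linear systems with more unknowns than equations, and independence of
  characters\<close>

lemma underdetermined_system:
  fixes M :: "'i \<Rightarrow> 'j \<Rightarrow> 'a::field"
  assumes "finite B" "finite A" "card B < card A"
  shows "\<exists>c. (\<exists>a\<in>A. c a \<noteq> 0) \<and> (\<forall>b\<in>B. (\<Sum>a\<in>A. c a * M a b) = 0)"
  using assms
proof (induction B arbitrary: A M rule: finite_induct)
  case empty
  then obtain a where "a \<in> A"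
    by fastforce
  then show ?case
    by (intro exI[of _ "\<lambda>_. 1"]) auto
next
  case (insert b B)
  show ?case
  proof (cases "\<forall>a\<in>A. M a b = 0")
    case True
    then show ?thesis
      using insert.IH[of A M] insert by auto
  next
    case False
    then obtain p where p: "p \<in> A" "M p b \<noteq> 0"
      by blast
    \<comment> \<open>Gaussian elimination: equation b is solved for the unknown with index p and
      substituted into the other equations. The value \<open>- s\<close> below is the one that
      equation b then forces at p.\<close>
    define M' where "M' = (\<lambda>a y. M a y - M a b / M p b * M p y)"
    have "card B < card (A - {p})"
      using insert p by simp
    then obtain c where c: "\<exists>a\<in>A - {p}. c a \<noteq> 0"
      "\<And>y. y \<in> B \<Longrightarrow> (\<Sum>a\<in>A - {p}. c a * M' a y) = 0"
      using insert.IH[of "A - {p}" M'] insert.prems by auto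
    define s where "s = (\<Sum>a\<in>A - {p}. c a * (M a b / M p b))"
    define c' where "c' = (\<lambda>a. if a = p then - s else c a)"
    have eq: "(\<Sum>a\<in>A. c' a * M a y) = (\<Sum>a\<in>A - {p}. c a * M' a y)" for y
    proof -
      have "(\<Sum>a\<in>A. c' a * M a y) = - s * M p y + (\<Sum>a\<in>A - {p}. c a * M a y)"
        using insert.prems p by (subst sum.remove[of A p]) (auto simp: c'_def intro!: sum.cong)
      then show ?thesis
        by (simp add: s_def M'_def sum_subtractf sum_distrib_right right_diff_distrib mult.assoc)
    qed
    have "(\<Sum>a\<in>A - {p}. c a * M' a b) = 0"
      using p by (simp add: M'_def)
    then have "\<forall>y\<in>insert b B. (\<Sum>a\<in>A. c' a * M a y) = 0"
      using c(2) eq by auto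
    moreover have "\<exists>a\<in>A. c' a \<noteq> 0"
      using c(1) by (auto simp: c'_def)
    ultimately show ?thesis
      by blast
  qed
qed

text \<open>Dedekind's lemma: a shortest nontrivial relation is shortened by comparing it with its
  translate by an element on which two of the characters differ.\<close>
lemma dedekind_independence:
  fixes c :: "('a \<Rightarrow> 'b::field) \<Rightarrow> 'b"
  assumes "finite A"
    and "\<And>\<sigma> x y. \<lbrakk>\<sigma> \<in> A; x \<in> L; y \<in> L\<rbrakk> \<Longrightarrow> \<sigma> (m x y) = \<sigma> x * \<sigma> y"
    and "\<And>x y. \<lbrakk>x \<in> L; y \<in> L\<rbrakk> \<Longrightarrow> m x y \<in> L"
    and "u \<in> L" "\<And>\<sigma>. \<sigma> \<in> A \<Longrightarrow> \<sigma> u \<noteq> 0"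
    and "\<And>\<sigma> \<tau>. \<lbrakk>\<sigma> \<in> A; \<tau> \<in> A; \<sigma> \<noteq> \<tau>\<rbrakk> \<Longrightarrow> \<exists>x\<in>L. \<sigma> x \<noteq> \<tau> x"
    and "\<And>x. x \<in> L \<Longrightarrow> (\<Sum>\<sigma>\<in>A. c \<sigma> * \<sigma> x) = 0"
    and "\<sigma> \<in> A"
  shows "c \<sigma> = 0"
  using assms
proof (induction A arbitrary: c \<sigma> rule: finite_induct)
  case empty
  then show ?case by simp
next
  case (insert \<tau> A)
  note rel = insert.prems(6)
  have zero: "c \<sigma> = 0" if \<sigma>: "\<sigma> \<in> A" for \<sigma>
  proof -
    obtain y where y: "y \<in> L" "\<sigma> y \<noteq> \<tau> y"
      using insert.prems(5)[of \<sigma> \<tau>] \<sigma> insert.hyps by auto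
    have "c \<sigma> * (\<sigma> y - \<tau> y) = 0"
    proof (rule insert.IH[of "\<lambda>\<sigma>. c \<sigma> * (\<sigma> y - \<tau> y)"])
      fix x assume x: "x \<in> L"
      have "(\<Sum>\<sigma>\<in>insert \<tau> A. c \<sigma> * \<sigma> (m y x)) - \<tau> y * (\<Sum>\<sigma>\<in>insert \<tau> A. c \<sigma> * \<sigma> x) = 0"
        using rel[OF insert.prems(2)[OF y(1) x]] rel[OF x] by simp
      also have "(\<Sum>\<sigma>\<in>insert \<tau> A. c \<sigma> * \<sigma> (m y x)) = (\<Sum>\<sigma>\<in>insert \<tau> A. c \<sigma> * (\<sigma> y * \<sigma> x))"
        using insert.prems(1) x y by (intro sum.cong) auto
      finally have "(\<Sum>\<sigma>\<in>insert \<tau> A. c \<sigma> * (\<sigma> y - \<tau> y) * \<sigma> x) = 0"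
        by (simp add: sum_distrib_left sum_subtractf algebra_simps)
      then show "(\<Sum>\<sigma>\<in>A. c \<sigma> * (\<sigma> y - \<tau> y) * \<sigma> x) = 0"
        using insert.hyps by simp
    qed (use insert.prems \<sigma> in auto)
    then show ?thesis
      using y by simp
  qed
  have "c \<tau> * \<tau> u = 0"
    using rel[OF insert.prems(3)] insert.hyps zero by simp
  then have "c \<tau> = 0"
    using insert.prems(4) by simp
  then show ?case
    using zero insert.prems(7) by blast
qed

section \<open>Automorphisms of number fields\<close>

lemma subfield_C_D:
  assumes "subfield_C K"
  shows "0 \<in> K" "1 \<in> K" "\<And>x y. \<lbrakk>x \<in> K; y \<in> K\<rbrakk> \<Longrightarrow> x + y \<in> K"
    "\<And>x y. \<lbrakk>x \<in> K; y \<in> K\<rbrakk> \<Longrightarrow> x * y \<in> K" "\<And>x y. \<lbrakk>x \<in> K; y \<in> K\<rbrakk> \<Longrightarrow> x - y \<in> K"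
    "\<And>x. x \<in> K \<Longrightarrow> inverse x \<in> K" "\<And>x. x \<in> K \<Longrightarrow> - x \<in> K"
    "\<And>x n. x \<in> K \<Longrightarrow> x ^ n \<in> K" "\<And>x e. x \<in> K \<Longrightarrow> x powi e \<in> K"
    "\<And>f A. (\<And>a. a \<in> A \<Longrightarrow> f a \<in> K) \<Longrightarrow> sum f A \<in> K"
    "\<And>f A. (\<And>a. a \<in> A \<Longrightarrow> f a \<in> K) \<Longrightarrow> prod f A \<in> K"
proof -
  show 1: "0 \<in> K" "1 \<in> K" "\<And>x y. \<lbrakk>x \<in> K; y \<in> K\<rbrakk> \<Longrightarrow> x + y \<in> K"
    "\<And>x y. \<lbrakk>x \<in> K; y \<in> K\<rbrakk> \<Longrightarrow> x * y \<in> K" "\<And>x y. \<lbrakk>x \<in> K; y \<in> K\<rbrakk> \<Longrightarrow> x - y \<in> K"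
    using assms by (auto simp: subfield_C_def)
  show inv: "inverse x \<in> K" if "x \<in> K" for x
    using assms that by (cases "x = 0") (auto simp: subfield_C_def)
  show "- x \<in> K" if "x \<in> K" for x
    using 1(5)[OF 1(1) that] by simp
  show pow: "x ^ n \<in> K" if "x \<in> K" for x n
    using that 1 by (induction n) auto
  show "x powi e \<in> K" if "x \<in> K" for x e
    using that pow inv by (auto simp: power_int_def)
  show "sum f A \<in> K" if "\<And>a. a \<in> A \<Longrightarrow> f a \<in> K" for f :: "'a \<Rightarrow> complex" and A
    using that 1 by (induction A rule: infinite_finite_induct) auto
  show "prod f A \<in> K" if "\<And>a. a \<in> A \<Longrightarrow> f a \<in> K" for f :: "'b \<Rightarrow> complex" and A
    using that 1 by (induction A rule: infinite_finite_induct) auto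
qed

lemma Rats_subset_subfield_C:
  assumes "subfield_C K"
  shows "\<rat> \<subseteq> K"
proof
  fix x :: complex assume "x \<in> \<rat>"
  then obtain a b where x: "x = of_int a / of_int b"
    by (auto elim: Rats_cases')
  have nat: "of_nat n \<in> K" for n
    using subfield_C_D[OF assms] by (induction n) auto
  have int: "of_int i \<in> K" for i
    using nat subfield_C_D(7)[OF assms] by (cases i rule: int_cases2) auto
  show "x \<in> K"
    unfolding x divide_inverse by (intro subfield_C_D(4)[OF assms] subfield_C_D(6)[OF assms] int)
qed

lemma autD:
  assumes "\<sigma> \<in> aut L K"
  shows "bij_betw \<sigma> L L" "\<And>x. x \<in> L \<Longrightarrow> \<sigma> x \<in> L"
    "\<And>x y. \<lbrakk>x \<in> L; y \<in> L\<rbrakk> \<Longrightarrow> \<sigma> (x + y) = \<sigma> x + \<sigma> y"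
    "\<And>x y. \<lbrakk>x \<in> L; y \<in> L\<rbrakk> \<Longrightarrow> \<sigma> (x * y) = \<sigma> x * \<sigma> y"
    "\<And>x. x \<in> K \<Longrightarrow> \<sigma> x = x" "\<And>x. x \<notin> L \<Longrightarrow> \<sigma> x = x"
  using assms by (auto simp: aut_def bij_betw_def)

lemma aut_antimono: "K \<subseteq> K' \<Longrightarrow> aut L K' \<subseteq> aut L K"
  by (auto simp: aut_def)

text \<open>Being the identity off L, an automorphism permutes all complex numbers; thus
  \<open>inv\<close> is its genuine inverse and the group laws hold as equations between total
  functions.\<close>

lemma aut_bij:
  assumes "\<sigma> \<in> aut L K"
  shows "bij \<sigma>"
proof -
  have "bij_betw \<sigma> (- L) (- L)"
    using autD(6)[OF assms] by (intro bij_betwI[where g = "\<lambda>x. x"]) auto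
  then have "bij_betw \<sigma> (L \<union> - L) (L \<union> - L)"
    by (intro bij_betw_combine autD(1)[OF assms]) auto
  then show ?thesis
    by simp
qed

lemma aut_inv_comp:
  assumes "\<sigma> \<in> aut L K"
  shows "\<sigma> \<circ> inv \<sigma> = id" "inv \<sigma> \<circ> \<sigma> = id"
    "\<And>x. \<sigma> (inv \<sigma> x) = x" "\<And>x. inv \<sigma> (\<sigma> x) = x"
  using aut_bij[OF assms] by (auto simp: bij_def surj_iff fun_eq_iff surj_f_inv_f)

lemma aut_id: "id \<in> aut L K"
  by (auto simp: aut_def)

lemma aut_comp:
  assumes "\<sigma> \<in> aut L K" "\<tau> \<in> aut L K"
  shows "\<sigma> \<circ> \<tau> \<in> aut L K"
  using assms bij_betw_trans[OF autD(1)[OF assms(2)] autD(1)[OF assms(1)]] autD[OF assms(1)] autD[OF assms(2)]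
  by (simp add: aut_def)

lemma aut_inv:
  assumes "\<sigma> \<in> aut L K" "subfield_C L" "K \<subseteq> L"
  shows "inv \<sigma> \<in> aut L K"
proof -
  note i = aut_inv_comp[OF assms(1)]
  have inL: "inv \<sigma> x \<in> L" if "x \<in> L" for x
  proof -
    have "x \<in> \<sigma> ` L"
      using autD(1)[OF assms(1)] that by (simp add: bij_betw_def)
    then obtain y where "y \<in> L" "x = \<sigma> y"
      by blast
    then show ?thesis
      by (simp add: i(4))
  qed
  have "bij_betw (inv \<sigma>) L L"
    by (rule bij_betwI[where g = \<sigma>]) (simp_all add: i(3,4) inL autD(2)[OF assms(1)])
  moreover have "inv \<sigma> (x + y) = inv \<sigma> x + inv \<sigma> y"
    if "x \<in> L" "y \<in> L" for x y
  proof -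
    have "\<sigma> (inv \<sigma> x + inv \<sigma> y) = x + y"
      using autD(3)[OF assms(1) inL[OF that(1)] inL[OF that(2)]] by (simp add: i(3))
    then show ?thesis
      using i(4)[of "inv \<sigma> x + inv \<sigma> y"] by simp
  qed
  moreover have "inv \<sigma> (x * y) = inv \<sigma> x * inv \<sigma> y"
    if "x \<in> L" "y \<in> L" for x y
  proof -
    have "\<sigma> (inv \<sigma> x * inv \<sigma> y) = x * y"
      using autD(4)[OF assms(1) inL[OF that(1)] inL[OF that(2)]] by (simp add: i(3))
    then show ?thesis
      using i(4)[of "inv \<sigma> x * inv \<sigma> y"] by simp
  qed
  moreover have "inv \<sigma> x = x" if "x \<in> K" for x
    using i(4)[of x] autD(5)[OF assms(1) that] by simp
  moreover have "inv \<sigma> x = x" if "x \<notin> L" for x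
    using i(4)[of x] autD(6)[OF assms(1) that] by simp
  ultimately show ?thesis
    by (simp add: aut_def)
qed

lemma aut_hom:
  assumes "\<sigma> \<in> aut L K" "subfield_C L"
  shows "\<sigma> 0 = 0" "\<sigma> 1 = 1" "\<And>x. x \<in> L \<Longrightarrow> \<sigma> x = 0 \<longleftrightarrow> x = 0"
    "\<And>x. x \<in> L \<Longrightarrow> \<sigma> (inverse x) = inverse (\<sigma> x)"
    "\<And>x n. x \<in> L \<Longrightarrow> \<sigma> (x ^ n) = \<sigma> x ^ n"
    "\<And>x e. x \<in> L \<Longrightarrow> \<sigma> (x powi e) = \<sigma> x powi e"
    "\<And>f A. (\<And>a. a \<in> A \<Longrightarrow> f a \<in> L) \<Longrightarrow> \<sigma> (sum f A) = (\<Sum>a\<in>A. \<sigma> (f a))"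
    "\<And>f A. (\<And>a. a \<in> A \<Longrightarrow> f a \<in> L) \<Longrightarrow> \<sigma> (prod f A) = (\<Prod>a\<in>A. \<sigma> (f a))"
proof -
  note s = autD[OF assms(1)] and L = subfield_C_D[OF assms(2)]
  have inj: "\<sigma> x = \<sigma> y \<longleftrightarrow> x = y" for x y
    using aut_bij[OF assms(1)] by (auto simp: bij_def inj_def)
  show z: "\<sigma> 0 = 0"
    using s(3)[OF L(1) L(1)] by simp
  show nz: "\<sigma> x = 0 \<longleftrightarrow> x = 0" for x
    using inj[of x 0] z by simp
  show one: "\<sigma> 1 = 1"
    using s(4)[OF L(2) L(2)] nz[of 1] by simp
  show iv: "\<sigma> (inverse x) = inverse (\<sigma> x)" if "x \<in> L" for x
    using s(4)[OF that L(6)[OF that]] one z nz[of x]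
    by (cases "x = 0") (auto simp: field_simps)
  show pw: "\<sigma> (x ^ n) = \<sigma> x ^ n" if "x \<in> L" for x n
    using that by (induction n) (auto simp: one s L)
  show "\<sigma> (x powi e) = \<sigma> x powi e" if "x \<in> L" for x e
    using that pw iv L by (auto simp: power_int_def)
  show "\<sigma> (sum f A) = (\<Sum>a\<in>A. \<sigma> (f a))" if "\<And>a. a \<in> A \<Longrightarrow> f a \<in> L" for f :: "'a \<Rightarrow> complex" and A
    using that by (induction A rule: infinite_finite_induct) (auto simp: z s L)
  show "\<sigma> (prod f A) = (\<Prod>a\<in>A. \<sigma> (f a))" if "\<And>a. a \<in> A \<Longrightarrow> f a \<in> L" for f :: "'b \<Rightarrow> complex" and A
    using that by (induction A rule: infinite_finite_induct) (auto simp: one s L)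
qed

lemma aut_poly:
  assumes "\<sigma> \<in> aut L K" "subfield_C L" "K \<subseteq> L" "\<And>i. coeff p i \<in> K" "x \<in> L"
  shows "\<sigma> (poly p x) = poly p (\<sigma> x)"
proof -
  note s = autD[OF assms(1)] and L = subfield_C_D[OF assms(2)] and h = aut_hom[OF assms(1,2)]
  have mem: "coeff p i \<in> L" "x ^ i \<in> L" for i
    using assms L by auto
  then have "\<sigma> (poly p x) = (\<Sum>i\<le>degree p. \<sigma> (coeff p i * x ^ i))"
    unfolding poly_altdef using L by (intro h) auto
  also have "\<dots> = poly p (\<sigma> x)"
    unfolding poly_altdef using s mem h assms by (intro sum.cong) auto
  finally show ?thesis .
qed

text \<open>With more automorphisms than elements of B, some nontrivial combination of the
  automorphisms vanishes on B. Automorphisms over K are K-linear, so the combination vanishes on all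
  of L, against Dedekind's lemma. The set A is an arbitrary finite part of the group because
  finiteness of the group is itself deduced from this bound.\<close>

lemma card_aut_le_spanning:
  assumes "subfield_C L" "K \<subseteq> L" "A \<subseteq> aut L K" "finite A" "finite B" "B \<subseteq> L" "spans_over K B L"
  shows "card A \<le> card B"
proof (rule ccontr)
  assume "\<not> card A \<le> card B"
  then obtain c where c: "\<exists>\<sigma>\<in>A. c \<sigma> \<noteq> 0" "\<And>b. b \<in> B \<Longrightarrow> (\<Sum>\<sigma>\<in>A. c \<sigma> * \<sigma> b) = 0"
    using underdetermined_system[OF assms(5,4), of "\<lambda>\<sigma> b. \<sigma> b"] by auto
  note L = subfield_C_D[OF assms(1)]
  have "c \<sigma> = 0" if \<sigma>: "\<sigma> \<in> A" for \<sigma>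
  proof (rule dedekind_independence[of A L "(*)" 1 c])
    show "\<sigma> (x * y) = \<sigma> x * \<sigma> y" if "\<sigma> \<in> A" "x \<in> L" "y \<in> L" for \<sigma> x y
      using autD(4) assms(3) that by blast
    show "\<sigma> 1 \<noteq> 0" if "\<sigma> \<in> A" for \<sigma>
      using aut_hom(2)[OF subsetD[OF assms(3) that] assms(1)] by simp
    show "\<exists>x\<in>L. \<sigma> x \<noteq> \<tau> x" if "\<sigma> \<in> A" "\<tau> \<in> A" "\<sigma> \<noteq> \<tau>" for \<sigma> \<tau>
    proof (rule ccontr)
      assume *: "\<not> (\<exists>x\<in>L. \<sigma> x \<noteq> \<tau> x)"
      have "\<sigma> x = \<tau> x" for x
        using * autD(6)[of \<sigma> L K x] autD(6)[of \<tau> L K x] subsetD[OF assms(3) that(1)]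
          subsetD[OF assms(3) that(2)] by (cases "x \<in> L") auto
      then show False
        using that(3) by auto
    qed
    show "(\<Sum>\<sigma>\<in>A. c \<sigma> * \<sigma> x) = 0" if x: "x \<in> L" for x
    proof -
      obtain d where d: "\<And>b. b \<in> B \<Longrightarrow> d b \<in> K" "x = (\<Sum>b\<in>B. d b * b)"
        using assms(7) x unfolding spans_over_def by blast
      have "c \<sigma> * \<sigma> x = (\<Sum>b\<in>B. d b * (c \<sigma> * \<sigma> b))" if "\<sigma> \<in> A" for \<sigma>
      proof -
        have s: "\<sigma> \<in> aut L K"
          using that assms(3) by blast
        have "\<sigma> x = (\<Sum>b\<in>B. \<sigma> (d b * b))"
          unfolding d(2) using d(1) assms(2,6) L by (intro aut_hom(7)[OF s assms(1)]) blast
        also have "\<dots> = (\<Sum>b\<in>B. d b * \<sigma> b)"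
          using d(1) assms(2,6) autD(4,5)[OF s] by (intro sum.cong) (auto simp: subset_iff)
        finally show ?thesis
          by (simp add: sum_distrib_left mult.left_commute)
      qed
      then have "(\<Sum>\<sigma>\<in>A. c \<sigma> * \<sigma> x) = (\<Sum>\<sigma>\<in>A. \<Sum>b\<in>B. d b * (c \<sigma> * \<sigma> b))"
        by (intro sum.cong refl)
      also have "\<dots> = (\<Sum>b\<in>B. d b * (\<Sum>\<sigma>\<in>A. c \<sigma> * \<sigma> b))"
        unfolding sum_distrib_left by (rule sum.swap)
      also have "\<dots> = 0"
        using c(2) by simp
      finally show ?thesis .
    qed
  qed (fact assms(4) L(4) L(2) \<sigma>)+
  then show False
    using c(1) by blast
qed

lemma finite_aut:
  assumes "number_field L" "K \<subseteq> L" "subfield_C K"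
  shows "finite (aut L K)"
proof -
  obtain B where B: "finite B" "B \<subseteq> L" "spans_over \<rat> B L" and L: "subfield_C L"
    using assms(1) by (auto simp: number_field_def)
  have "finite (aut L \<rat>)"
  proof (rule ccontr)
    assume "infinite (aut L \<rat>)"
    then obtain A where A: "finite A" "card A = Suc (card B)" "A \<subseteq> aut L \<rat>"
      using infinite_arbitrarily_large by blast
    show False
      using card_aut_le_spanning[OF L Rats_subset_subfield_C[OF L] A(3,1) B] A(2) by simp
  qed
  then show ?thesis
    using aut_antimono[OF Rats_subset_subfield_C[OF assms(3)]] finite_subset by blast
qed

text \<open>A finite rational spanning set also spans over K, so the minimum in \<open>fdeg\<close>
  is attained by an actual spanning set, to which the previous bound applies.\<close>

lemma card_aut_le_fdeg:
  assumes "number_field L" "K \<subseteq> L" "subfield_C K"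
  shows "card (aut L K) \<le> fdeg K L"
proof -
  obtain B where B: "finite B" "B \<subseteq> L" "spans_over \<rat> B L" and L: "subfield_C L"
    using assms(1) by (auto simp: number_field_def)
  have "spans_over K B L"
    using B(3) Rats_subset_subfield_C[OF assms(3)] unfolding spans_over_def by (meson subset_iff)
  then have "\<exists>n B. finite B \<and> B \<subseteq> L \<and> card B = n \<and> spans_over K B L"
    using B by blast
  then have "\<exists>B. finite B \<and> B \<subseteq> L \<and> card B = fdeg K L \<and> spans_over K B L"
    unfolding fdeg_def by (rule LeastI_ex)
  then obtain C where C: "finite C" "C \<subseteq> L" "card C = fdeg K L" "spans_over K C L"
    by blast
  show ?thesis
    using card_aut_le_spanning[OF L assms(2) subset_refl finite_aut[OF assms] C(1,2,4)] C(3) by simp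
qed

section \<open>Polynomials over a subfield\<close>

definition poly_over :: "complex set \<Rightarrow> complex poly set" where
  "poly_over K = {p. \<forall>i. coeff p i \<in> K}"

lemma poly_overD: "p \<in> poly_over K \<Longrightarrow> coeff p i \<in> K"
  by (simp add: poly_over_def)

lemma poly_over_mono: "K \<subseteq> K' \<Longrightarrow> poly_over K \<subseteq> poly_over K'"
  by (auto simp: poly_over_def)

lemma poly_over_closed:
  assumes "subfield_C K"
  shows "0 \<in> poly_over K" "1 \<in> poly_over K"
    "\<And>c. c \<in> K \<Longrightarrow> [:c:] \<in> poly_over K"
    "\<And>c n. c \<in> K \<Longrightarrow> monom c n \<in> poly_over K"
    "\<And>c p. \<lbrakk>c \<in> K; p \<in> poly_over K\<rbrakk> \<Longrightarrow> pCons c p \<in> poly_over K"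
    "\<And>c p. \<lbrakk>c \<in> K; p \<in> poly_over K\<rbrakk> \<Longrightarrow> Polynomial.smult c p \<in> poly_over K"
    "\<And>p q. \<lbrakk>p \<in> poly_over K; q \<in> poly_over K\<rbrakk> \<Longrightarrow> p + q \<in> poly_over K"
    "\<And>p q. \<lbrakk>p \<in> poly_over K; q \<in> poly_over K\<rbrakk> \<Longrightarrow> p - q \<in> poly_over K"
    "\<And>p q. \<lbrakk>p \<in> poly_over K; q \<in> poly_over K\<rbrakk> \<Longrightarrow> p * q \<in> poly_over K"
    "\<And>p q. \<lbrakk>p \<in> poly_over K; q \<in> poly_over K\<rbrakk> \<Longrightarrow> pcompose p q \<in> poly_over K"
    "\<And>p. p \<in> poly_over K \<Longrightarrow> pderiv p \<in> poly_over K"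
    "\<And>p x. \<lbrakk>p \<in> poly_over K; x \<in> K\<rbrakk> \<Longrightarrow> poly p x \<in> K"
proof -
  note K = subfield_C_D[OF assms]
  show z: "0 \<in> poly_over K" and "1 \<in> poly_over K"
    using K(1,2) by (auto simp: poly_over_def)
  show pc: "pCons c p \<in> poly_over K" if "c \<in> K" "p \<in> poly_over K" for c p
    using that by (auto simp: poly_over_def coeff_pCons split: nat.split)
  show c: "[:c:] \<in> poly_over K" if "c \<in> K" for c
    using pc[OF that z] .
  show "monom c n \<in> poly_over K" if "c \<in> K" for c n
    using that K(1) by (auto simp: poly_over_def)
  show "Polynomial.smult c p \<in> poly_over K" if "c \<in> K" "p \<in> poly_over K" for c p
    using that K(4) by (auto simp: poly_over_def)
  show add: "p + q \<in> poly_over K" if "p \<in> poly_over K" "q \<in> poly_over K" for p q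
    using that K(3) by (auto simp: poly_over_def)
  show "p - q \<in> poly_over K" if "p \<in> poly_over K" "q \<in> poly_over K" for p q
    using that K(5) by (auto simp: poly_over_def)
  show mult: "p * q \<in> poly_over K" if "p \<in> poly_over K" "q \<in> poly_over K" for p q
    using that by (auto simp: poly_over_def coeff_mult intro!: K(10) K(4))
  show "pcompose p q \<in> poly_over K" if "p \<in> poly_over K" "q \<in> poly_over K" for p q
    using that
  proof (induction p)
    case (pCons a p)
    have "a \<in> K" "p \<in> poly_over K"
      using poly_overD[OF pCons.prems(1), of 0] poly_overD[OF pCons.prems(1), of "Suc _"]
      by (auto simp: poly_over_def)
    then show ?case
      using pCons by (auto simp: pcompose_pCons intro!: add mult c)
  qed (simp add: z)
  show "pderiv p \<in> poly_over K" if "p \<in> poly_over K" for p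
  proof -
    have "of_nat n \<in> K" for n
      using Rats_subset_subfield_C[OF assms] by auto
    then show ?thesis
      using that K(4) by (auto simp: poly_over_def coeff_pderiv simp del: of_nat_Suc)
  qed
  show "poly p x \<in> K" if "p \<in> poly_over K" "x \<in> K" for p x
    unfolding poly_altdef using that by (intro K(10) K(4) K(8)) (auto simp: poly_over_def)
qed

text \<open>Long division. Each step cancels the leading term with a quotient of leading
  coefficients, which stays in K; this is why quotient and remainder have coefficients in K.\<close>

lemma poly_over_division:
  assumes "subfield_C K" "m \<in> poly_over K" "m \<noteq> 0" "f \<in> poly_over K"
  shows "\<exists>q\<in>poly_over K. \<exists>r\<in>poly_over K. f = m * q + r \<and> (r = 0 \<or> degree r < degree m)"
  using assms(4)
proof (induction "degree f" arbitrary: f rule: less_induct)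
  case less
  note C = poly_over_closed[OF assms(1)] and K = subfield_C_D[OF assms(1)]
  show ?case
  proof (cases "f = 0 \<or> degree f < degree m")
    case True
    then show ?thesis
      using less.prems C(1) by (intro bexI[of _ 0] bexI[of _ f]) auto
  next
    case False
    define s where "s = monom (lead_coeff f / lead_coeff m) (degree f - degree m)"
    define g where "g = f - m * s"
    have "lead_coeff f / lead_coeff m \<in> K"
      unfolding divide_inverse
      using less.prems assms(2) by (intro K(4) K(6)) (auto simp: poly_over_def)
    then have s: "s \<in> poly_over K"
      unfolding s_def by (rule C(4))
    then have g: "g \<in> poly_over K"
      unfolding g_def using less.prems assms(2) C(8,9) by blast
    have nz: "lead_coeff f / lead_coeff m \<noteq> 0"
      using False assms(3) by simp
    have deg: "degree (m * s) = degree f"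
      using False assms(3) nz by (subst degree_mult_eq) (auto simp: s_def degree_monom_eq)
    have lc: "coeff (m * s) (degree f) = coeff f (degree f)"
    proof -
      have "lead_coeff (m * s) = lead_coeff f"
        using assms(3) nz by (simp add: lead_coeff_mult s_def degree_monom_eq)
      then show ?thesis
        by (simp add: deg)
    qed
    \<comment> \<open>A constant f has no smaller degree to fall to, so in that case cancelling the
      leading term leaves 0.\<close>
    have "g = 0 \<or> degree g < degree f"
    proof (cases "degree f = 0")
      case True
      then have "degree g = 0"
        using degree_diff_le[of f 0 "m * s"] deg by (simp add: g_def)
      moreover have "coeff g 0 = 0"
        using lc True by (simp add: g_def)
      ultimately show ?thesis
        by (metis leading_coeff_0_iff)
    next
      case f0: False
      have "degree g \<le> degree f"
        unfolding g_def using deg by (intro degree_diff_le) auto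
      moreover have "coeff g (degree f) = 0"
        using lc by (simp add: g_def)
      ultimately show ?thesis
        using f0 by (metis eq_zero_or_degree_less)
    qed
    then show ?thesis
    proof
      assume "g = 0"
      then show ?thesis
        using s C(1) by (intro bexI[of _ s] bexI[of _ 0]) (auto simp: g_def)
    next
      assume "degree g < degree f"
      then obtain q r where qr: "q \<in> poly_over K" "r \<in> poly_over K" "g = m * q + r"
        "r = 0 \<or> degree r < degree m"
        using less.hyps g by blast
      then have "f = m * (q + s) + r"
        by (simp add: g_def algebra_simps)
      then show ?thesis
        using qr C(7)[OF qr(1) s] by blast
    qed
  qed
qed

text \<open>Least degree takes the place of irreducibility, and the leading coefficient is not
  normalised: only degrees, divisibility and roots matter later.\<close>

definition is_minpoly :: "complex set \<Rightarrow> complex \<Rightarrow> complex poly \<Rightarrow> bool" where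
  "is_minpoly K x m \<longleftrightarrow> m \<in> poly_over K \<and> m \<noteq> 0 \<and> poly m x = 0 \<and>
     (\<forall>f\<in>poly_over K. f \<noteq> 0 \<longrightarrow> poly f x = 0 \<longrightarrow> degree m \<le> degree f)"

lemma ex_minpoly:
  assumes "p \<in> poly_over K" "p \<noteq> 0" "poly p x = 0"
  obtains m where "is_minpoly K x m"
proof -
  define P where "P = (\<lambda>f. f \<in> poly_over K \<and> f \<noteq> 0 \<and> poly f x = 0)"
  have "P (arg_min degree P)" "\<And>f. P f \<Longrightarrow> degree (arg_min degree P) \<le> degree f"
    using assms arg_min_nat_lemma[of P p degree] by (auto simp: P_def)
  then show ?thesis
    by (intro that[of "arg_min degree P"]) (auto simp: P_def is_minpoly_def)
qed

lemma minpoly_dvd: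
  assumes "subfield_C K" "is_minpoly K x m" "f \<in> poly_over K" "poly f x = 0"
  shows "\<exists>q\<in>poly_over K. f = m * q"
proof -
  have m: "m \<in> poly_over K" "m \<noteq> 0" "poly m x = 0"
    "\<And>f. \<lbrakk>f \<in> poly_over K; f \<noteq> 0; poly f x = 0\<rbrakk> \<Longrightarrow> degree m \<le> degree f"
    using assms(2) by (auto simp: is_minpoly_def)
  obtain q r where qr: "q \<in> poly_over K" "r \<in> poly_over K" "f = m * q + r"
    "r = 0 \<or> degree r < degree m"
    using poly_over_division[OF assms(1) m(1,2) assms(3)] by blast
  have "poly r x = 0"
    using qr(3) assms(4) m(3) by simp
  then have "r = 0"
    using m(4)[OF qr(2)] qr(4) by force
  then show ?thesis
    using qr by auto
qed

lemma minpoly_degree_pos: "is_minpoly K x m \<Longrightarrow> degree m > 0"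
  by (metis degree_eq_zeroE is_minpoly_def neq0_conv pCons_0_0 poly_const_conv)

text \<open>This is irreducibility in disguise. A minimal polynomial n of z divides m; the cofactor
  has smaller degree than m and cannot vanish at x, so n vanishes at x and has the same degree as
  m.\<close>

lemma minpoly_root:
  assumes "subfield_C K" "is_minpoly K x m" "poly m z = 0"
  shows "is_minpoly K z m"
proof -
  have m: "m \<in> poly_over K" "m \<noteq> 0" "poly m x = 0"
    using assms(2) by (auto simp: is_minpoly_def)
  obtain n where n: "is_minpoly K z n"
    using ex_minpoly[OF m(1,2) assms(3)] .
  then have n': "n \<in> poly_over K" "n \<noteq> 0" "degree n > 0"
    using minpoly_degree_pos by (auto simp: is_minpoly_def)
  obtain q where q: "q \<in> poly_over K" "m = n * q"
    using minpoly_dvd[OF assms(1) n m(1) assms(3)] by blast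
  have "poly n x = 0 \<or> poly q x = 0"
    using m(3) q(2) by simp
  moreover have "poly q x \<noteq> 0"
  proof
    assume "poly q x = 0"
    then have "degree m \<le> degree q"
      using assms(2) q m(2) by (auto simp: is_minpoly_def)
    moreover have "degree m = degree n + degree q"
      using q(2) m(2) by (auto simp: degree_mult_eq)
    ultimately show False
      using n'(3) by simp
  qed
  ultimately have "degree m \<le> degree n"
    using assms(2) n' by (auto simp: is_minpoly_def)
  then show ?thesis
    using n m assms(3) by (auto simp: is_minpoly_def)
qed

text \<open>A double root z would also be a root of \<open>pderiv m\<close>, which is nonzero in
  characteristic 0 and of smaller degree, although m is minimal for z as well.\<close>

lemma minpoly_separable:
  assumes "subfield_C K" "is_minpoly K x m"
  shows "rsquarefree m"
  unfolding rsquarefree_roots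
proof (intro allI notI)
  fix z assume z: "poly m z = 0 \<and> poly (pderiv m) z = 0"
  have m: "m \<in> poly_over K" "degree m > 0"
    using assms(2) minpoly_degree_pos by (auto simp: is_minpoly_def)
  have "pderiv m \<noteq> 0"
    using m(2) by (simp add: pderiv_eq_0_iff)
  then have "degree m \<le> degree (pderiv m)"
    using minpoly_root[OF assms, of z] z poly_over_closed(11)[OF assms(1) m(1)]
    by (simp add: is_minpoly_def)
  then show False
    using m(2) by (simp add: degree_pderiv)
qed

lemma card_minpoly_roots:
  assumes "subfield_C K" "is_minpoly K x m"
  shows "card {z. poly m z = 0} = degree m"
proof -
  have m: "m \<noteq> 0"
    using assms(2) by (auto simp: is_minpoly_def)
  have "degree (Polynomial.smult (lead_coeff m) (\<Prod>z | poly m z = 0. [:- z, 1:])) = card {z. poly m z = 0}"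
    using m by (simp add: degree_prod_eq_sum_degree)
  then show ?thesis
    unfolding complex_poly_decompose_rsquarefree[OF minpoly_separable[OF assms]] by simp
qed

section \<open>Simple algebraic extensions\<close>

definition adjoin :: "complex set \<Rightarrow> complex \<Rightarrow> complex set" where
  "adjoin K \<theta> = {poly f \<theta> | f. f \<in> poly_over K}"

text \<open>Only inverses are at stake, and they come from a Euclidean descent on the degree of f: a
  polynomial of degree at least \<open>degree m\<close> is reduced modulo m, and for a smaller one m
  is divided by f.\<close>

lemma subfield_adjoin:
  assumes K: "subfield_C K" and p: "p \<in> poly_over K" "p \<noteq> 0" "poly p \<theta> = 0"
  shows "subfield_C (adjoin K \<theta>)"
proof -
  note C = poly_over_closed[OF K]
  obtain m where m: "is_minpoly K \<theta> m"
    using ex_minpoly[OF p] .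
  then have m': "m \<in> poly_over K" "m \<noteq> 0" "poly m \<theta> = 0"
    "\<And>f. \<lbrakk>f \<in> poly_over K; f \<noteq> 0; poly f \<theta> = 0\<rbrakk> \<Longrightarrow> degree m \<le> degree f"
    by (auto simp: is_minpoly_def)
  have inv: "\<exists>g\<in>poly_over K. poly f \<theta> * poly g \<theta> = 1" if "f \<in> poly_over K" "poly f \<theta> \<noteq> 0" for f
    using that
  proof (induction "degree f" arbitrary: f rule: less_induct)
    case less
    have f0: "f \<noteq> 0"
      using less.prems by auto
    consider "degree f = 0" | "degree f > 0" "degree m \<le> degree f" | "degree f > 0" "degree f < degree m"
      by linarith
    then show ?case
    proof cases
      case 1
      then obtain c where c: "f = [:c:]"
        by (auto elim: degree_eq_zeroE)
      then have "c \<in> K" "c \<noteq> 0"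
        using less.prems poly_overD[of f K 0] by auto
      then show ?thesis
        using c subfield_C_D(6)[OF K] C(3) by (intro bexI[of _ "[:inverse c:]"]) auto
    next
      case 2
      obtain q r where qr: "q \<in> poly_over K" "r \<in> poly_over K" "f = m * q + r"
        "r = 0 \<or> degree r < degree m"
        using poly_over_division[OF K m'(1,2) less.prems(1)] by blast
      have "poly r \<theta> = poly f \<theta>"
        using qr(3) m'(3) by simp
      then show ?thesis
        using less.hyps[of r] qr 2 less.prems by fastforce
    next
      case 3
      obtain q r where qr: "q \<in> poly_over K" "r \<in> poly_over K" "m = f * q + r"
        "r = 0 \<or> degree r < degree f"
        using poly_over_division[OF K less.prems(1) f0 m'(1)] by blast
      \<comment> \<open>Since m vanishes at \<theta>, an inverse of r at \<theta> yields one of f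
        after multiplication by -q. The remainder r is nonzero, for otherwise q would vanish at
        \<theta> with a degree below that of m.\<close>
      have r: "poly r \<theta> = - (poly f \<theta> * poly q \<theta>)"
        using qr(3) m'(3) by (simp add: eq_neg_iff_add_eq_0 add.commute)
      have "r \<noteq> 0"
      proof
        assume "r = 0"
        then have mq: "m = f * q" "poly q \<theta> = 0"
          using qr(3) r less.prems by auto
        then have "q \<noteq> 0"
          using m'(2) by auto
        then have "degree m = degree f + degree q" "degree m \<le> degree q"
          using m'(4)[OF qr(1)] f0 degree_mult_eq[of f q] mq by metis+
        then show False
          using 3 by simp
      qed
      then have "degree r < degree f" "poly r \<theta> \<noteq> 0"
        using qr(2,4) m'(4) 3 by force+
      then obtain g where g: "g \<in> poly_over K" "poly r \<theta> * poly g \<theta> = 1"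
        using less.hyps qr(2) by blast
      have "poly f \<theta> * poly (0 - q * g) \<theta> = 1"
        using g(2) r by (simp add: mult_ac)
      then show ?thesis
        using C(8)[OF C(1) C(9)[OF qr(1) g(1)]] by blast
    qed
  qed
  have "inverse x \<in> adjoin K \<theta>" if x: "x \<in> adjoin K \<theta>" "x \<noteq> 0" for x
  proof -
    obtain f where f: "f \<in> poly_over K" "x = poly f \<theta>"
      using x(1) by (auto simp: adjoin_def)
    then obtain g where "g \<in> poly_over K" "x * poly g \<theta> = 1"
      using inv x(2) by blast
    then show ?thesis
      using inverse_unique[of x "poly g \<theta>"] by (auto simp: adjoin_def)
  qed
  moreover have "0 \<in> adjoin K \<theta>" "1 \<in> adjoin K \<theta>"
    unfolding adjoin_def using C(1,2) by (auto intro: exI[of _ 0] exI[of _ 1])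
  moreover have "x + y \<in> adjoin K \<theta>" "x * y \<in> adjoin K \<theta>" "x - y \<in> adjoin K \<theta>"
    if xy: "x \<in> adjoin K \<theta>" "y \<in> adjoin K \<theta>" for x y
  proof -
    obtain f g where fg: "f \<in> poly_over K" "g \<in> poly_over K" "x = poly f \<theta>" "y = poly g \<theta>"
      using xy by (auto simp: adjoin_def)
    have "poly (f + g) \<theta> \<in> adjoin K \<theta>" "poly (f * g) \<theta> \<in> adjoin K \<theta>" "poly (f - g) \<theta> \<in> adjoin K \<theta>"
      unfolding adjoin_def using C(7,8,9)[OF fg(1,2)] by blast+
    then show "x + y \<in> adjoin K \<theta>" "x * y \<in> adjoin K \<theta>" "x - y \<in> adjoin K \<theta>"
      by (simp_all add: fg(3,4))
  qed
  ultimately show ?thesis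
    unfolding subfield_C_def by simp
qed

section \<open>Primitive elements and the fixed field\<close>

lemma adjoin_mono_mem:
  assumes "subfield_C F" "K \<subseteq> F" "\<theta> \<in> F"
  shows "adjoin K \<theta> \<subseteq> F"
proof
  fix x assume "x \<in> adjoin K \<theta>"
  then obtain f where "f \<in> poly_over K" "x = poly f \<theta>"
    by (auto simp: adjoin_def)
  then show "x \<in> F"
    using poly_over_closed(12)[OF assms(1) _ assms(3)] poly_over_mono[OF assms(2)] by blast
qed

lemma subset_adjoin:
  assumes "subfield_C K"
  shows "K \<subseteq> adjoin K \<theta>" "\<theta> \<in> adjoin K \<theta>"
proof -
  have "poly [:c:] \<theta> \<in> adjoin K \<theta>" if "c \<in> K" for c
    using that poly_over_closed(3)[OF assms] unfolding adjoin_def by blast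
  then show "K \<subseteq> adjoin K \<theta>"
    by auto
  have "poly [:0, 1:] \<theta> \<in> adjoin K \<theta>"
    using poly_over_closed(5)[OF assms _ poly_over_closed(3)[OF assms]] subfield_C_D(1,2)[OF assms]
    unfolding adjoin_def by blast
  then show "\<theta> \<in> adjoin K \<theta>"
    by simp
qed

lemma subfield_Rats: "subfield_C \<rat>"
  by (simp add: subfield_C_def)

text \<open>For all but finitely many rational \<open>c\<close> the element \<open>a + c b\<close> is primitive: over
  \<open>\<rat>(a + c b)\<close> the minimal polynomial of \<open>b\<close> divides both \<open>q(X)\<close> and
  \<open>p(a + c b - c X)\<close>, whose only common root is \<open>b\<close>.\<close>
lemma primitive_element_two:
  assumes p: "p \<in> poly_over \<rat>" "p \<noteq> 0" "poly p a = 0"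
    and q: "q \<in> poly_over \<rat>" "q \<noteq> 0" "poly q b = 0"
    and alg: "\<And>c. c \<in> \<rat> \<Longrightarrow> \<exists>f\<in>poly_over \<rat>. f \<noteq> 0 \<and> poly f (a + c * b) = 0"
  shows "\<exists>c\<in>\<rat>. a \<in> adjoin \<rat> (a + c * b) \<and> b \<in> adjoin \<rat> (a + c * b)"
proof -
  \<comment> \<open>The value c is bad if s - a = c (b - t) for roots s of p and t of q, which makes
    t a second common root. Pairs with t = b contribute a division by zero, hence the value 0, so
    that c = 0 is excluded too, harmlessly.\<close>
  define bad where "bad = (\<lambda>(s, t). (s - a) / (b - t)) ` ({s. poly p s = 0} \<times> {t. poly q t = 0})"
  have "finite bad"
    unfolding bad_def using p(2) q(2) by (intro finite_imageI finite_cartesian_product poly_roots_finite)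
  then have "finite {n :: nat. of_nat n \<in> bad}"
    using finite_vimageI[of bad "of_nat :: nat \<Rightarrow> complex"] by (auto simp: inj_on_def vimage_def)
  then obtain n :: nat where n: "of_nat n \<notin> bad"
    by (metis finite_nat_set_iff_bounded less_irrefl mem_Collect_eq)
  define c :: complex where "c = of_nat n"
  have c: "c \<in> \<rat>" "c \<notin> bad"
    using n by (auto simp: c_def)
  define \<theta> where "\<theta> = a + c * b"
  define K where "K = adjoin \<rat> \<theta>"
  have K: "subfield_C K"
    unfolding K_def using alg[OF c(1)] subfield_adjoin[OF subfield_Rats] by (auto simp: \<theta>_def)
  note C = poly_over_closed[OF K] and F = subfield_C_D[OF K]
  have cK: "c \<in> K" "\<theta> \<in> K" and QK: "\<rat> \<subseteq> K"
    using c(1) subset_adjoin[OF subfield_Rats, of \<theta>] by (auto simp: K_def)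
  have pq: "p \<in> poly_over K" "q \<in> poly_over K"
    using p q poly_over_mono[OF QK] by auto
  define P where "P = pcompose p [:\<theta>, - c:]"
  have P: "P \<in> poly_over K"
    unfolding P_def using pq(1) cK F(7) by (intro C(10) C(5) C(3)) auto
  have Pb: "poly P b = 0"
    using p(3) by (simp add: P_def poly_pcompose \<theta>_def mult.commute)
  obtain m where m: "is_minpoly K b m"
    using ex_minpoly[OF pq(2) q(2,3)] .
  have m': "m \<in> poly_over K" "m \<noteq> 0" "poly m b = 0"
    using m by (auto simp: is_minpoly_def)
  have root: "z = b" if z: "poly m z = 0" for z
  proof (rule ccontr)
    assume "z \<noteq> b"
    have "poly q z = 0" "poly P z = 0"
      using minpoly_dvd[OF K m pq(2) q(3)] minpoly_dvd[OF K m P Pb] z by auto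
    then have "poly p (\<theta> - c * z) = 0"
      by (simp add: P_def poly_pcompose mult.commute)
    then have "((\<theta> - c * z) - a) / (b - z) \<in> bad"
      unfolding bad_def using \<open>poly q z = 0\<close> by (intro image_eqI[of _ _ "(\<theta> - c * z, z)"]) auto
    moreover have "((\<theta> - c * z) - a) / (b - z) = c"
      using \<open>z \<noteq> b\<close> by (simp add: \<theta>_def field_simps)
    ultimately show False
      using c(2) by simp
  qed
  have "{z. poly m z = 0} = {b}"
    using root m'(3) by blast
  \<comment> \<open>Minimal polynomials have simple roots, so a single root means degree 1, and b is
    a quotient of coefficients from K.\<close>
  then have "degree m = 1"
    using card_minpoly_roots[OF K m] by simp
  then obtain u v where uv: "m = [:u, v:]" "v \<noteq> 0"
    by (meson degree1_coeffs)
  then have "u \<in> K" "v \<in> K"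
    using poly_overD[OF m'(1), of 0] poly_overD[OF m'(1), of 1] by auto
  moreover have "b = - u * inverse v"
    using m'(3) uv by (simp add: field_simps eq_neg_iff_add_eq_0)
  ultimately have b: "b \<in> K"
    by (simp add: F(4,6,7))
  have "a = \<theta> - c * b"
    by (simp add: \<theta>_def)
  then have "a \<in> K"
    by (simp add: F(4,5) cK b)
  then show ?thesis
    using b c(1) by (auto simp: K_def \<theta>_def)
qed

lemma galois_algebraic:
  assumes "galois_over_Q L" "x \<in> L"
  shows "\<exists>p\<in>poly_over \<rat>. p \<noteq> 0 \<and> poly p x = 0 \<and> (\<forall>z. poly p z = 0 \<longrightarrow> z \<in> L)"
proof -
  obtain p :: "complex poly" where "p \<noteq> 0" "\<forall>i. coeff p i \<in> \<rat>" "poly p x = 0"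
    "\<forall>z. poly p z = 0 \<longrightarrow> z \<in> L"
    using assms by (auto simp: galois_over_Q_def)
  then show ?thesis
    by (intro bexI[of _ p]) (auto simp: poly_over_def)
qed

lemma galois_subfield: "galois_over_Q L \<Longrightarrow> subfield_C L"
  by (simp add: galois_over_Q_def number_field_def)

text \<open>The elements of a finite spanning set are absorbed one at a time. Every intermediate
  generator lies in L and is therefore algebraic, which keeps the two-generator step
  applicable.\<close>

lemma primitive_element:
  assumes L: "galois_over_Q L"
  obtains \<theta> where "\<theta> \<in> L" "L = adjoin \<rat> \<theta>"
proof -
  note LF = galois_subfield[OF L]
  obtain B where B: "finite B" "B \<subseteq> L" "spans_over \<rat> B L"
    using L by (auto simp: galois_over_Q_def number_field_def)
  have "\<exists>\<theta>\<in>L. B \<subseteq> adjoin \<rat> \<theta>"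
    using B(1,2)
  proof (induction B rule: finite_induct)
    case empty
    then show ?case
      using subfield_C_D(1)[OF LF] by auto
  next
    case (insert b B)
    then obtain a where a: "a \<in> L" "B \<subseteq> adjoin \<rat> a" and b: "b \<in> L"
      by auto
    have mem: "a + c * b \<in> L" if "c \<in> \<rat>" for c
      using a(1) b that Rats_subset_subfield_C[OF LF] subfield_C_D(3,4)[OF LF] by blast
    have "\<exists>c\<in>\<rat>. a \<in> adjoin \<rat> (a + c * b) \<and> b \<in> adjoin \<rat> (a + c * b)"
      using galois_algebraic[OF L a(1)] galois_algebraic[OF L b] galois_algebraic[OF L mem]
        primitive_element_two by metis
    then obtain c where c: "c \<in> \<rat>" "a \<in> adjoin \<rat> (a + c * b)" "b \<in> adjoin \<rat> (a + c * b)"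
      by blast
    have "subfield_C (adjoin \<rat> (a + c * b))"
      using galois_algebraic[OF L mem[OF c(1)]] subfield_adjoin[OF subfield_Rats] by blast
    then have "adjoin \<rat> a \<subseteq> adjoin \<rat> (a + c * b)"
      using adjoin_mono_mem subset_adjoin(1)[OF subfield_Rats] c(2) by blast
    then show ?case
      using a(2) c(3) mem[OF c(1)] by blast
  qed
  then obtain \<theta> where \<theta>: "\<theta> \<in> L" "B \<subseteq> adjoin \<rat> \<theta>"
    by blast
  have K: "subfield_C (adjoin \<rat> \<theta>)"
    using galois_algebraic[OF L \<theta>(1)] subfield_adjoin[OF subfield_Rats] by blast
  have "x \<in> adjoin \<rat> \<theta>" if x: "x \<in> L" for x
  proof -
    obtain d where d: "\<And>b. b \<in> B \<Longrightarrow> d b \<in> \<rat>" "x = (\<Sum>b\<in>B. d b * b)"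
      using B(3) x unfolding spans_over_def by blast
    show ?thesis
      unfolding d(2) using d(1) \<theta>(2) subset_adjoin(1)[OF subfield_Rats]
      by (intro subfield_C_D(10)[OF K] subfield_C_D(4)[OF K]) blast+
  qed
  moreover have "adjoin \<rat> \<theta> \<subseteq> L"
    using adjoin_mono_mem[OF LF Rats_subset_subfield_C[OF LF] \<theta>(1)] .
  ultimately show ?thesis
    using that[OF \<theta>(1)] by blast
qed

text \<open>The automorphism sends f(\<theta>) to f(\<theta>'). It is well defined because every
  rational polynomial vanishing at \<theta> is a multiple of m and so vanishes at \<theta>'.\<close>

lemma ex_aut_primitive:
  assumes L: "galois_over_Q L" and \<theta>: "\<theta> \<in> L" "L = adjoin \<rat> \<theta>"
    and m: "is_minpoly \<rat> \<theta> m" "poly m \<theta>' = 0"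
  shows "\<exists>\<sigma>\<in>aut L \<rat>. \<forall>f\<in>poly_over \<rat>. \<sigma> (poly f \<theta>) = poly f \<theta>'"
proof -
  note LF = galois_subfield[OF L] and C = poly_over_closed[OF subfield_Rats]
  note F = subfield_C_D[OF LF]
  obtain p where p: "p \<in> poly_over \<rat>" "poly p \<theta> = 0" "\<And>z. poly p z = 0 \<Longrightarrow> z \<in> L"
    using galois_algebraic[OF L \<theta>(1)] by blast
  have wd: "poly f \<theta>' = 0" if "f \<in> poly_over \<rat>" "poly f \<theta> = 0" for f
    using minpoly_dvd[OF subfield_Rats m(1) that] m(2) by auto
  then have \<theta>': "\<theta>' \<in> L"
    using p by blast
  define \<sigma> where "\<sigma> = (\<lambda>x. if x \<in> L then poly (SOME f. f \<in> poly_over \<rat> \<and> poly f \<theta> = x) \<theta>' else x)"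
  have inL: "poly f \<theta> \<in> L" if "f \<in> poly_over \<rat>" for f
    using that \<theta>(2) by (auto simp: adjoin_def)
  have \<sigma>: "\<sigma> (poly f \<theta>) = poly f \<theta>'" if f: "f \<in> poly_over \<rat>" for f
  proof -
    define g where "g = (SOME g. g \<in> poly_over \<rat> \<and> poly g \<theta> = poly f \<theta>)"
    have g: "g \<in> poly_over \<rat> \<and> poly g \<theta> = poly f \<theta>"
      unfolding g_def by (rule someI[of _ f]) (use f in auto)
    have "poly (g - f) \<theta>' = 0"
      using g f by (intro wd C(8)) auto
    then show ?thesis
      using inL[OF f] by (simp add: \<sigma>_def g_def)
  qed
  have ex: "\<exists>f\<in>poly_over \<rat>. x = poly f \<theta>" if "x \<in> L" for x
    using that \<theta>(2) by (auto simp: adjoin_def)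
  have add: "\<sigma> (x + y) = \<sigma> x + \<sigma> y" and mult: "\<sigma> (x * y) = \<sigma> x * \<sigma> y" if xy: "x \<in> L" "y \<in> L" for x y
  proof -
    obtain f g where fg: "f \<in> poly_over \<rat>" "g \<in> poly_over \<rat>" "x = poly f \<theta>" "y = poly g \<theta>"
      using ex xy by meson
    show "\<sigma> (x + y) = \<sigma> x + \<sigma> y" "\<sigma> (x * y) = \<sigma> x * \<sigma> y"
      using \<sigma>[OF C(7)[OF fg(1,2)]] \<sigma>[OF C(9)[OF fg(1,2)]] \<sigma>[OF fg(1)] \<sigma>[OF fg(2)] fg(3,4)
      by simp_all
  qed
  have rat: "\<sigma> x = x" if "x \<in> \<rat>" for x
    using \<sigma>[OF C(3)[OF that]] by simp
  have into: "\<sigma> x \<in> L" if x: "x \<in> L" for x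
  proof -
    obtain f where f: "f \<in> poly_over \<rat>" "x = poly f \<theta>"
      using ex[OF x] by blast
    have "f \<in> poly_over L"
      using f(1) poly_over_mono[OF Rats_subset_subfield_C[OF LF]] by blast
    then show ?thesis
      unfolding f(2) \<sigma>[OF f(1)] by (rule poly_over_closed(12)[OF LF _ \<theta>'])
  qed
  have inj: "inj_on \<sigma> L"
  proof (rule inj_onI, rule ccontr)
    fix x y assume xy: "x \<in> L" "y \<in> L" "\<sigma> x = \<sigma> y" "x \<noteq> y"
    have "\<sigma> (x - y) = 0"
      using add[OF F(5)[OF xy(1,2)] xy(2)] xy(3) by simp
    moreover have "\<sigma> (x - y) * \<sigma> (inverse (x - y)) = 1"
      using mult[OF F(5)[OF xy(1,2)] F(6)[OF F(5)[OF xy(1,2)]]] rat[of 1] xy(4) by simp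
    ultimately show False
      by simp
  qed
  have poly: "\<sigma> (poly f x) = poly f (\<sigma> x)" if f: "f \<in> poly_over \<rat>" and x: "x \<in> L" for f x
  proof -
    obtain g where g: "g \<in> poly_over \<rat>" "x = poly g \<theta>"
      using ex[OF x] by blast
    show ?thesis
      using \<sigma>[OF C(10)[OF f g(1)]] \<sigma>[OF g(1)] by (simp add: poly_pcompose g(2))
  qed
  \<comment> \<open>Surjectivity by counting: \<sigma> maps the finite root set R of a rational
    polynomial injectively into itself, and R lies in L.\<close>
  have "y \<in> \<sigma> ` L" if y: "y \<in> L" for y
  proof -
    obtain f where f: "f \<in> poly_over \<rat>" "f \<noteq> 0" "poly f y = 0" "\<And>z. poly f z = 0 \<Longrightarrow> z \<in> L"
      using galois_algebraic[OF L y] by blast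
    define R where "R = {z. poly f z = 0}"
    have R: "R \<subseteq> L" "finite R"
      using f(2,4) poly_roots_finite by (auto simp: R_def)
    have "\<sigma> z \<in> R" if "z \<in> R" for z
      using poly[OF f(1), of z] R(1) rat[of 0] that by (auto simp: R_def)
    then have "\<sigma> ` R = R"
      using inj_on_subset[OF inj R(1)] R(2) by (intro endo_inj_surj) auto
    moreover have "y \<in> R"
      using f(3) by (simp add: R_def)
    ultimately show ?thesis
      using R(1) by blast
  qed
  then have "bij_betw \<sigma> L L"
    using inj into by (auto simp: bij_betw_def)
  then have "\<sigma> \<in> aut L \<rat>"
    unfolding aut_def using add mult rat by (auto simp: \<sigma>_def)
  then show ?thesis
    using \<sigma> by blast
qed

text \<open>Write x = f(\<theta>) with f of degree below that of m. Every root z of m is the image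
  of \<theta> under an automorphism, so f(z) = x. Thus f - x has more roots than its degree allows,
  f is constant, and x is a rational coefficient.\<close>

theorem fixed_field_galois:
  assumes L: "galois_over_Q L" and x: "x \<in> L" "\<And>\<sigma>. \<sigma> \<in> aut L \<rat> \<Longrightarrow> \<sigma> x = x"
  shows "x \<in> \<rat>"
proof -
  obtain \<theta> where \<theta>: "\<theta> \<in> L" "L = adjoin \<rat> \<theta>"
    using primitive_element[OF L] .
  obtain m where m: "is_minpoly \<rat> \<theta> m"
    using galois_algebraic[OF L \<theta>(1)] ex_minpoly by blast
  then have m': "m \<in> poly_over \<rat>" "m \<noteq> 0" "poly m \<theta> = 0"
    by (auto simp: is_minpoly_def)
  obtain g where g: "g \<in> poly_over \<rat>" "x = poly g \<theta>"
    using x(1) \<theta>(2) by (auto simp: adjoin_def)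
  obtain q f where qf: "f \<in> poly_over \<rat>" "g = m * q + f" "f = 0 \<or> degree f < degree m"
    using poly_over_division[OF subfield_Rats m'(1,2) g(1)] by blast
  have xf: "x = poly f \<theta>"
    using g(2) qf(2) m'(3) by simp
  have deg: "degree f < degree m"
    using qf(3) minpoly_degree_pos[OF m] by auto
  have "poly (f - [:x:]) z = 0" if z: "poly m z = 0" for z
  proof -
    obtain \<sigma> where \<sigma>: "\<sigma> \<in> aut L \<rat>" "\<sigma> (poly f \<theta>) = poly f z"
      using ex_aut_primitive[OF L \<theta> m z] qf(1) by blast
    then show ?thesis
      using x(2)[OF \<sigma>(1)] xf by simp
  qed
  then have sub: "{z. poly m z = 0} \<subseteq> {z. poly (f - [:x:]) z = 0}"
    by blast
  have "f - [:x:] = 0"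
  proof (rule ccontr)
    assume nz: "f - [:x:] \<noteq> 0"
    have "degree m \<le> card {z. poly (f - [:x:]) z = 0}"
      using card_mono[OF poly_roots_finite[OF nz] sub] card_minpoly_roots[OF subfield_Rats m] by simp
    also have "\<dots> \<le> degree (f - [:x:])"
      by (rule card_poly_roots_bound[OF nz])
    also have "\<dots> \<le> degree f"
      using degree_diff_le[of f "degree f" "[:x:]"] by simp
    finally show False
      using deg by simp
  qed
  then have "coeff f 0 = x"
    by simp
  then show ?thesis
    using poly_overD[OF qf(1)] by metis
qed

section \<open>Units and permutation groups\<close>

lemma alg_integer_iff_algebraic_int: "alg_integer x \<longleftrightarrow> algebraic_int x"
  unfolding alg_integer_def algebraic_int_altdef_ipoly by auto

lemma units_of_int_1: "subfield_C L \<Longrightarrow> 1 \<in> units_of_int L"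
  by (simp add: units_of_int_def alg_integer_iff_algebraic_int subfield_C_D(2))

lemma units_of_int_mult:
  assumes "subfield_C L" "x \<in> units_of_int L" "y \<in> units_of_int L"
  shows "x * y \<in> units_of_int L"
  using assms alg_integer_mult subfield_C_D(4)[OF assms(1)] by (auto simp: units_of_int_def)

lemma units_of_int_inverse:
  assumes "subfield_C L" "x \<in> units_of_int L"
  shows "inverse x \<in> units_of_int L"
  using assms subfield_C_D(6)[OF assms(1)] by (auto simp: units_of_int_def)

lemma units_of_int_powi:
  assumes "subfield_C L" "x \<in> units_of_int L"
  shows "x powi e \<in> units_of_int L"
proof -
  have "y ^ n \<in> units_of_int L" if "y \<in> units_of_int L" for y n
    using that by (induction n) (simp_all add: units_of_int_1 units_of_int_mult assms(1))
  then show ?thesis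
    using assms units_of_int_inverse by (auto simp: power_int_def)
qed

lemma units_of_int_prod:
  assumes "subfield_C L" "\<And>i. i \<in> A \<Longrightarrow> f i \<in> units_of_int L"
  shows "prod f A \<in> units_of_int L"
  using assms(2)
  by (induction A rule: infinite_finite_induct) (simp_all add: units_of_int_1 units_of_int_mult assms(1))

lemma alg_integer_aut:
  assumes "\<sigma> \<in> aut L \<rat>" "subfield_C L" "x \<in> L" "alg_integer x"
  shows "alg_integer (\<sigma> x)"
proof -
  obtain p :: "int poly" where p: "lead_coeff p = 1" "poly (map_poly of_int p) x = 0"
    using assms(4) by (auto simp: alg_integer_def)
  have "poly (map_poly of_int p) (\<sigma> x) = \<sigma> (poly (map_poly of_int p) x)"
    using assms Rats_subset_subfield_C by (intro aut_poly[symmetric]) (auto simp: coeff_map_poly)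
  then show ?thesis
    using p aut_hom(1)[OF assms(1,2)] by (auto simp: alg_integer_def)
qed

lemma units_of_int_aut:
  assumes "\<sigma> \<in> aut L \<rat>" "subfield_C L" "x \<in> units_of_int L"
  shows "\<sigma> x \<in> units_of_int L"
proof -
  have x: "x \<in> L" "inverse x \<in> L" "x \<noteq> 0" "alg_integer x" "alg_integer (inverse x)"
    using assms(2,3) by (auto simp: units_of_int_def subfield_C_D(6))
  show ?thesis
    using alg_integer_aut[OF assms(1,2) x(1,4)] alg_integer_aut[OF assms(1,2) x(2,5)] x
      aut_hom(3,4)[OF assms(1,2) x(1)] autD(2)[OF assms(1) x(1)]
    by (simp add: units_of_int_def)
qed

text \<open>Groups are sets of permutations under composition, so G, H, W and P share one type and
  one multiplication; finiteness is built in because they serve as index sets of sums and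
  products.\<close>

locale perm_group =
  fixes G :: "('a \<Rightarrow> 'a) set"
  assumes fin: "finite G" and id_mem [simp]: "id \<in> G"
    and comp_mem [simp]: "\<lbrakk>a \<in> G; b \<in> G\<rbrakk> \<Longrightarrow> a \<circ> b \<in> G"
    and inv_mem [simp]: "a \<in> G \<Longrightarrow> inv a \<in> G"
    and bij_mem: "a \<in> G \<Longrightarrow> bij a"
begin

lemma inv_simps [simp]:
  assumes "a \<in> G"
  shows "a \<circ> inv a = id" "inv a \<circ> a = id" "a \<circ> (inv a \<circ> x) = x" "inv a \<circ> (a \<circ> x) = x"
    "a (inv a z) = z" "inv a (a z) = z" "inv (inv a) = a"
proof -
  show 1: "a \<circ> inv a = id" "inv a \<circ> a = id"
    using bij_mem[OF assms] by (auto simp: bij_def surj_iff)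
  show "a \<circ> (inv a \<circ> x) = x" "inv a \<circ> (a \<circ> x) = x"
    by (simp_all add: 1 o_assoc)
  show "a (inv a z) = z" "inv a (a z) = z"
    using 1 by (auto simp: fun_eq_iff)
  show "inv (inv a) = a"
    using bij_mem[OF assms] by (rule inv_inv_eq)
qed

lemma inv_comp: "\<lbrakk>a \<in> G; b \<in> G\<rbrakk> \<Longrightarrow> inv (a \<circ> b) = inv b \<circ> inv a"
  using bij_mem by (auto intro: o_inv_distrib)

lemma sum_left:
  assumes "a \<in> G"
  shows "(\<Sum>g\<in>G. X (a \<circ> g)) = (\<Sum>g\<in>G. X g)"
  by (rule sum.reindex_bij_witness[where i = "\<lambda>g. inv a \<circ> g" and j = "\<lambda>g. a \<circ> g"]) (use assms in simp_all)

lemma sum_right: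
  assumes "a \<in> G"
  shows "(\<Sum>g\<in>G. X (g \<circ> a)) = (\<Sum>g\<in>G. X g)"
  by (rule sum.reindex_bij_witness[where i = "\<lambda>g. g \<circ> inv a" and j = "\<lambda>g. g \<circ> a"])
    (use assms in \<open>simp_all add: comp_assoc\<close>)

lemma sum_inv: "(\<Sum>g\<in>G. X (inv g)) = (\<Sum>g\<in>G. X g)"
  by (rule sum.reindex_bij_witness[where i = inv and j = inv]) simp_all

lemma prod_left:
  assumes "a \<in> G"
  shows "(\<Prod>g\<in>G. X (a \<circ> g)) = (\<Prod>g\<in>G. X g)"
  by (rule prod.reindex_bij_witness[where i = "\<lambda>g. inv a \<circ> g" and j = "\<lambda>g. a \<circ> g"]) (use assms in simp_all)

lemma card_pos: "card G > 0"
  using fin id_mem by (metis card_gt_0_iff empty_iff)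

end

text \<open>Composition is a bijection from T \<times> W onto G, and X does not depend on the second
  factor. With X = 1 this is Lagrange's theorem.\<close>

lemma transversal_sum:
  fixes X :: "cauto \<Rightarrow> 'b::comm_semiring_1"
  assumes "perm_group G" "perm_group W" "W \<subseteq> G" "left_transversal G W T"
    and X: "\<And>g w. \<lbrakk>g \<in> G; w \<in> W\<rbrakk> \<Longrightarrow> X (g \<circ> w) = X g"
  shows "(\<Sum>g\<in>G. X g) = of_nat (card W) * (\<Sum>t\<in>T. X t)"
proof -
  interpret G: perm_group G by fact
  interpret W: perm_group W by fact
  have T: "T \<subseteq> G" and uniq: "\<And>g. g \<in> G \<Longrightarrow> \<exists>!t\<in>T. t \<in> lcoset g W"
    using assms(4) by (auto simp: left_transversal_def)
  have self: "g \<in> lcoset g W" for g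
    unfolding lcoset_def using W.id_mem by (metis comp_id image_eqI)
  have "bij_betw (\<lambda>(t, w). t \<circ> w) (T \<times> W) G"
    unfolding bij_betw_def
  proof
    show "inj_on (\<lambda>(t, w). t \<circ> w) (T \<times> W)"
    proof (rule inj_onI, clarify)
      fix t w t' w' assume *: "t \<in> T" "w \<in> W" "t' \<in> T" "w' \<in> W" "t \<circ> w = t' \<circ> w'"
      have tG: "t \<in> G" "t' \<in> G"
        using * T by auto
      have "t' = t \<circ> (w \<circ> inv w')"
        unfolding o_assoc *(5) using * by (simp add: comp_assoc)
      then have "t' \<in> lcoset t W"
        unfolding lcoset_def using * by simp
      then have "t = t'"
        using uniq[OF tG(1)] self[of t] *(1,3) by blast
      moreover have "w = inv t \<circ> (t \<circ> w)" "w' = inv t' \<circ> (t' \<circ> w')"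
        using tG by simp_all
      ultimately show "t = t' \<and> w = w'"
        using *(5) by metis
    qed
    show "(\<lambda>(t, w). t \<circ> w) ` (T \<times> W) = G"
    proof
      show "(\<lambda>(t, w). t \<circ> w) ` (T \<times> W) \<subseteq> G"
        using T assms(3) by (auto simp: subset_iff)
      show "G \<subseteq> (\<lambda>(t, w). t \<circ> w) ` (T \<times> W)"
      proof
        fix g assume g: "g \<in> G"
        then obtain t w where tw: "t \<in> T" "w \<in> W" "t = g \<circ> w"
          using uniq[OF g] by (auto simp: lcoset_def)
        then have "g = t \<circ> inv w"
          by (simp add: comp_assoc)
        then show "g \<in> (\<lambda>(t, w). t \<circ> w) ` (T \<times> W)"
          using tw by force
      qed
    qed
  qed
  then have "(\<Sum>g\<in>G. X g) = (\<Sum>p\<in>T \<times> W. X (case p of (t, w) \<Rightarrow> t \<circ> w))"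
    by (rule sum.reindex_bij_betw[symmetric])
  also have "\<dots> = (\<Sum>t\<in>T. \<Sum>w\<in>W. X (t \<circ> w))"
    by (simp add: sum.cartesian_product case_prod_unfold)
  also have "\<dots> = (\<Sum>t\<in>T. \<Sum>w\<in>W. X t)"
    using X T by (intro sum.cong refl) auto
  finally show ?thesis
    by (simp add: sum_distrib_left)
qed

text \<open>The convolution \<open>F = f * \<lambda>\<close> is annihilated by a matrix with negative off-diagonal entries
  and vanishing row sums, so by the maximum principle it is constant; as \<open>\<lambda>\<close> has mean zero the
  constant is 0, and \<open>F = 0\<close> says that \<open>f\<close> equals its average over each coset of \<open>P\<close>.\<close>
lemma convolution_kernel:
  fixes A f :: "cauto \<Rightarrow> real" and J :: real
  assumes "perm_group G" "perm_group P" "perm_group W" "W \<subseteq> P" "P \<subseteq> G"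
    and cardP: "real (card P) = J * real (card W)"
    and A: "\<And>g. \<lbrakk>g \<in> G; g \<notin> W\<rbrakk> \<Longrightarrow> A g < 0" "(\<Sum>g\<in>G. A g) = 0"
    and f: "\<And>g w. \<lbrakk>g \<in> G; w \<in> W\<rbrakk> \<Longrightarrow> f (g \<circ> w) = f g"
    and lam: "\<And>g. lam g = J * of_bool (g \<in> W) - of_bool (g \<in> P)"
    and rel: "\<And>h. h \<in> G \<Longrightarrow> (\<Sum>g\<in>G. f g * (\<Sum>x\<in>G. lam x * A (inv x \<circ> inv g \<circ> h))) = 0"
    and y: "y \<in> G" "p \<in> P"
  shows "f (y \<circ> p) = f y"
proof -
  interpret G: perm_group G by fact
  interpret P: perm_group P by fact
  interpret W: perm_group W by fact
  have WG: "W \<subseteq> G"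
    using assms(4,5) by blast
  have cancel: "a \<circ> b \<in> Q \<longleftrightarrow> a \<in> Q" if "perm_group Q" "Q \<subseteq> G" "a \<in> G" "b \<in> Q" for a b Q
  proof -
    interpret Q: perm_group Q by fact
    have "a = (a \<circ> b) \<circ> inv b"
      using that by (simp add: comp_assoc)
    then show ?thesis
      using that(4) Q.comp_mem Q.inv_mem by metis
  qed
  define F where "F = (\<lambda>y. \<Sum>g\<in>G. f g * lam (inv g \<circ> y))"
  have F_inv: "F (y \<circ> w) = F y" if "y \<in> G" "w \<in> W" for y w
    unfolding F_def
  proof (intro sum.cong refl)
    fix g assume g: "g \<in> G"
    have "inv g \<circ> (y \<circ> w) \<in> W \<longleftrightarrow> inv g \<circ> y \<in> W" "inv g \<circ> (y \<circ> w) \<in> P \<longleftrightarrow> inv g \<circ> y \<in> P"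
      using cancel[OF assms(3) WG, of "inv g \<circ> y" w] cancel[OF assms(2,5), of "inv g \<circ> y" w]
        g that assms(4) by (auto simp: comp_assoc)
    then show "f g * lam (inv g \<circ> (y \<circ> w)) = f g * lam (inv g \<circ> y)"
      by (simp add: lam)
  qed
  \<comment> \<open>Associativity of convolution: after the substitution y = g \<circ> x the double
    sum is the one in \<open>rel\<close>.\<close>
  have conv: "(\<Sum>y\<in>G. F y * A (inv y \<circ> h)) = 0" if h: "h \<in> G" for h
  proof -
    have "(\<Sum>y\<in>G. F y * A (inv y \<circ> h)) = (\<Sum>g\<in>G. \<Sum>y\<in>G. f g * lam (inv g \<circ> y) * A (inv y \<circ> h))"
      unfolding F_def sum_distrib_right by (rule sum.swap)
    also have "\<dots> = (\<Sum>g\<in>G. f g * (\<Sum>x\<in>G. lam x * A (inv x \<circ> inv g \<circ> h)))"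
    proof (intro sum.cong refl)
      fix g assume g: "g \<in> G"
      have "(\<Sum>y\<in>G. f g * lam (inv g \<circ> y) * A (inv y \<circ> h)) =
          (\<Sum>x\<in>G. f g * lam (inv g \<circ> (g \<circ> x)) * A (inv (g \<circ> x) \<circ> h))"
        by (rule G.sum_left[OF g, symmetric])
      also have "\<dots> = (\<Sum>x\<in>G. f g * lam x * A (inv x \<circ> inv g \<circ> h))"
        using g by (intro sum.cong refl) (simp add: G.inv_comp)
      finally show "(\<Sum>y\<in>G. f g * lam (inv g \<circ> y) * A (inv y \<circ> h)) =
          f g * (\<Sum>x\<in>G. lam x * A (inv x \<circ> inv g \<circ> h))"
        by (simp add: sum_distrib_left mult.assoc)
    qed
    finally show ?thesis
      using rel[OF h] by simp
  qed
  have "\<exists>y0\<in>G. \<forall>y\<in>G. F y \<le> F y0"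
  proof -
    have "Max (F ` G) \<in> F ` G"
      using G.fin G.card_pos by (intro Max_in) auto
    then obtain z where "z \<in> G" "Max (F ` G) = F z"
      by blast
    moreover have "\<forall>y\<in>G. F y \<le> Max (F ` G)"
      using G.fin by simp
    ultimately show ?thesis
      by metis
  qed
  then obtain y0 where y0: "y0 \<in> G" "\<And>y. y \<in> G \<Longrightarrow> F y \<le> F y0"
    by blast
  have in_W: "F y = F y0" if "y \<in> G" "inv y \<circ> y0 \<in> W" for y
    using F_inv[OF that] that(1) by simp
  \<comment> \<open>The row sum at \<open>y0\<close> vanishes, so the constant \<open>F y0\<close>
    may be subtracted from F without changing the relation.\<close>
  have "(\<Sum>y\<in>G. A (inv y \<circ> y0)) = 0"
    using G.sum_inv[of "\<lambda>g. A (g \<circ> y0)"] G.sum_right[OF y0(1), of A] A(2) by simp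
  then have "(\<Sum>y\<in>G. (F y - F y0) * A (inv y \<circ> y0)) = 0"
    unfolding left_diff_distrib sum_subtractf sum_distrib_left[symmetric] using conv[OF y0(1)] by simp
  \<comment> \<open>Away from W both factors are at most 0. On W, where the sign of A is not
    controlled, the first factor is 0 by the W-invariance of F.\<close>
  moreover have "(F y - F y0) * A (inv y \<circ> y0) \<ge> 0" if "y \<in> G" for y
  proof (cases "inv y \<circ> y0 \<in> W")
    case True
    then show ?thesis
      using in_W that by simp
  next
    case False
    then have "A (inv y \<circ> y0) < 0"
      using A(1) that y0(1) by simp
    then show ?thesis
      using y0(2)[OF that] by (simp add: mult_nonpos_nonpos)
  qed
  ultimately have zero: "(F y - F y0) * A (inv y \<circ> y0) = 0" if "y \<in> G" for y
    using that sum_nonneg_eq_0_iff[OF G.fin, of "\<lambda>y. (F y - F y0) * A (inv y \<circ> y0)"] by blast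
  have const: "F y = F y0" if "y \<in> G" for y
  proof (cases "inv y \<circ> y0 \<in> W")
    case False
    then have "A (inv y \<circ> y0) < 0"
      using A(1) that y0(1) by simp
    then show ?thesis
      using zero[OF that] by simp
  qed (use in_W that in simp)
  have card_bool: "(\<Sum>g\<in>G. of_bool (g \<in> Q)) = real (card Q)" if "Q \<subseteq> G" for Q
    using that G.fin by (simp add: of_bool_def sum.If_cases Int_absorb1)
  have "(\<Sum>y\<in>G. lam y) = 0"
    unfolding lam sum_subtractf sum_distrib_left[symmetric]
    by (simp add: card_bool WG assms(5) cardP)
  have "(\<Sum>y\<in>G. F y) = 0"
  proof -
    have "(\<Sum>y\<in>G. F y) = (\<Sum>g\<in>G. f g * (\<Sum>y\<in>G. lam (inv g \<circ> y)))"
      unfolding F_def sum_distrib_left by (rule sum.swap)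
    also have "\<dots> = (\<Sum>g\<in>G. f g * (\<Sum>y\<in>G. lam y))"
      by (intro sum.cong refl arg_cong2[of _ _ _ _ "(*)"] G.sum_left G.inv_mem)
    finally show ?thesis
      using \<open>(\<Sum>y\<in>G. lam y) = 0\<close> by simp
  qed
  moreover have "(\<Sum>y\<in>G. F y) = real (card G) * F y0"
    using const by simp
  ultimately have F0: "F y = 0" if "y \<in> G" for y
    using const[OF that] G.card_pos by simp
  \<comment> \<open>F = 0 written out: the W part of \<open>lam\<close> contributes J
    \<open>card W\<close> copies of f(y), which is \<open>card P\<close> copies, and the P part
    contributes the sum of f over the coset of y.\<close>
  have avg: "real (card P) * f y = (\<Sum>g\<in>G. f g * of_bool (inv g \<circ> y \<in> P))" if y: "y \<in> G" for y
  proof -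
    have "(\<Sum>g\<in>G. f g * of_bool (inv g \<circ> y \<in> W)) = sum f {g \<in> G. inv g \<circ> y \<in> W}"
      using G.fin by (intro sum.mono_neutral_cong_right) auto
    also have "\<dots> = (\<Sum>w\<in>W. f (y \<circ> w))"
    proof (rule sum.reindex_bij_witness[where i = "\<lambda>w. y \<circ> w" and j = "\<lambda>g. inv y \<circ> g"])
      fix g assume "g \<in> {g \<in> G. inv g \<circ> y \<in> W}"
      then have g: "g \<in> G" "inv g \<circ> y \<in> W"
        by auto
      have "inv (inv g \<circ> y) = inv y \<circ> g"
        using g(1) y by (simp add: G.inv_comp)
      then show "inv y \<circ> g \<in> W"
        using W.inv_mem[OF g(2)] by simp
      show "y \<circ> (inv y \<circ> g) = g" "f (y \<circ> (inv y \<circ> g)) = f g"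
        using y by simp_all
    next
      fix w assume w: "w \<in> W"
      then have "w \<in> G"
        using WG by blast
      then show "inv y \<circ> (y \<circ> w) = w" "y \<circ> w \<in> {g \<in> G. inv g \<circ> y \<in> W}"
        using y w by (simp_all add: G.inv_comp comp_assoc)
    qed
    also have "\<dots> = real (card W) * f y"
      using f[OF y] by simp
    finally have "F y = J * real (card W) * f y - (\<Sum>g\<in>G. f g * of_bool (inv g \<circ> y \<in> P))"
      unfolding F_def lam right_diff_distrib sum_subtractf mult.left_commute[of _ J]
        sum_distrib_left[symmetric] by simp
    then show ?thesis
      using F0[OF y] cardP by simp
  qed
  have "p \<in> G"
    using y assms(5) by blast
  have "(\<Sum>g\<in>G. f g * of_bool (inv g \<circ> (y \<circ> p) \<in> P)) = (\<Sum>g\<in>G. f g * of_bool (inv g \<circ> y \<in> P))"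
    using cancel[OF assms(2,5) _ y(2)] y(1) by (intro sum.cong refl) (simp add: o_assoc)
  then have "real (card P) * f (y \<circ> p) = real (card P) * f y"
    using avg[OF y(1)] avg[OF G.comp_mem[OF y(1) \<open>p \<in> G\<close>]] by simp
  then show ?thesis
    using P.card_pos by simp
qed

section \<open>The product formula and the tower\<close>

lemma perm_group_aut:
  assumes "number_field L" "K \<subseteq> L" "subfield_C K"
  shows "perm_group (aut L K)"
proof
  have L: "subfield_C L"
    using assms(1) by (simp add: number_field_def)
  show "finite (aut L K)"
    by (rule finite_aut[OF assms])
  show "inv a \<in> aut L K" if "a \<in> aut L K" for a
    using aut_inv[OF that L assms(2)] .
qed (auto intro: aut_id aut_comp aut_bij)

text \<open>The absolute norm is permuted into itself by every automorphism, hence rational. It and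
  its inverse are algebraic integers, so both are ordinary integers with product 1.\<close>

lemma cmod_norm_unit:
  assumes L: "galois_over_Q L" and x: "x \<in> units_of_int L"
  shows "cmod (\<Prod>\<sigma>\<in>aut L \<rat>. \<sigma> x) = 1"
proof -
  note LF = galois_subfield[OF L]
  interpret perm_group "aut L \<rat>"
    using L LF by (intro perm_group_aut subfield_Rats Rats_subset_subfield_C) (simp add: galois_over_Q_def)
  define N where "N = (\<Prod>\<sigma>\<in>aut L \<rat>. \<sigma> x)"
  have xL: "x \<in> L"
    using x by (simp add: units_of_int_def)
  have N: "N \<in> units_of_int L"
    unfolding N_def using units_of_int_aut[OF _ LF x] by (intro units_of_int_prod[OF LF])
  have "\<sigma> N = N" if \<sigma>: "\<sigma> \<in> aut L \<rat>" for \<sigma>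
  proof -
    have "\<sigma> N = (\<Prod>\<tau>\<in>aut L \<rat>. (\<sigma> \<circ> \<tau>) x)"
      unfolding N_def o_apply using autD(2) xL by (intro aut_hom(8)[OF \<sigma> LF]) blast
    also have "\<dots> = N"
      unfolding N_def by (rule prod_left[OF \<sigma>])
    finally show ?thesis .
  qed
  then have "N \<in> \<rat>"
    using N by (intro fixed_field_galois[OF L]) (auto simp: units_of_int_def)
  then have "N \<in> \<int>" "inverse N \<in> \<int>" "N \<noteq> 0"
    using N by (auto simp: units_of_int_def alg_integer_iff_algebraic_int
        intro!: rational_algebraic_int_is_int)
  then obtain a b where ab: "N = of_int a" "inverse N = of_int b"
    by (auto elim!: Ints_cases)
  have "of_int (a * b) = (1 :: complex)"
    using ab \<open>N \<noteq> 0\<close> by (metis of_int_mult right_inverse)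
  then have "a * b = 1"
    by (metis of_int_eq_1_iff)
  then have "\<bar>a\<bar> = 1"
    by (metis abs_1 abs_mult abs_zmult_eq_1)
  then show ?thesis
    using ab(1) by (simp add: N_def norm_of_int)
qed

text \<open>Summing over automorphisms instead of places avoids local degrees; for a unit the
  archimedean part is the whole product formula.\<close>

lemma product_formula:
  assumes L: "galois_over_Q L" and x: "x \<in> units_of_int L"
  shows "(\<Sum>\<sigma>\<in>aut L \<rat>. ln (cmod (\<sigma> x))) = 0"
proof -
  have nz: "\<sigma> x \<noteq> 0" if "\<sigma> \<in> aut L \<rat>" for \<sigma>
    using units_of_int_aut[OF that galois_subfield[OF L] x] by (simp add: units_of_int_def)
  have "finite (aut L \<rat>)"
    using L by (intro finite_aut subfield_Rats Rats_subset_subfield_C) (auto simp: galois_over_Q_def number_field_def)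
  then have "(\<Sum>\<sigma>\<in>aut L \<rat>. ln (cmod (\<sigma> x))) = ln (\<Prod>\<sigma>\<in>aut L \<rat>. cmod (\<sigma> x))"
    using nz by (intro ln_prod[symmetric]) auto
  then show ?thesis
    using cmod_norm_unit[OF assms] by (simp add: prod_norm)
qed

text \<open>This is the height identity for powers, including negative exponents: when the sum is 0,
  the positive and the negative parts have equal total size, so a change of sign does not alter the
  sum of positive parts.\<close>

lemma sum_max_0_mult:
  fixes a :: "'i \<Rightarrow> real"
  assumes "(\<Sum>i\<in>I. a i) = 0"
  shows "(\<Sum>i\<in>I. max 0 (c * a i)) = \<bar>c\<bar> * (\<Sum>i\<in>I. max 0 (a i))"
proof (cases "c \<ge> 0")
  case True
  then have "max 0 (c * a i) = c * max 0 (a i)" for i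
    by (auto simp: max_def mult_le_0_iff zero_le_mult_iff)
  then show ?thesis
    using True by (simp add: sum_distrib_left)
next
  case False
  then have "max 0 (c * a i) = (- c) * max 0 (a i) + c * a i" for i
    by (auto simp: max_def mult_le_0_iff zero_le_mult_iff)
  then have "(\<Sum>i\<in>I. max 0 (c * a i)) = (- c) * (\<Sum>i\<in>I. max 0 (a i)) + c * (\<Sum>i\<in>I. a i)"
    by (simp only: sum.distrib sum_distrib_left)
  then show ?thesis
    using False assms by simp
qed

lemma max_0_sum_le:
  fixes a :: "'i \<Rightarrow> real"
  shows "max 0 (\<Sum>i\<in>I. a i) \<le> (\<Sum>i\<in>I. max 0 (a i))"
  by (simp add: sum_mono sum_nonneg)

lemma prod_powi:
  fixes x :: "'i \<Rightarrow> complex"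
  shows "(\<Prod>i\<in>I. x i) powi e = (\<Prod>i\<in>I. x i powi e)"
  by (induction I rule: infinite_finite_induct) (simp_all add: power_int_mult_distrib)

lemma powi_sum:
  fixes x :: complex
  assumes "x \<noteq> 0"
  shows "x powi (\<Sum>i\<in>I. e i) = (\<Prod>i\<in>I. x powi e i)"
  using assms by (induction I rule: infinite_finite_induct) (simp_all add: power_int_add)

locale galois_tower =
  fixes l k :: "complex set" and w0 :: "complex \<Rightarrow> real"
  assumes gal_l: "galois_over_Q l" and gal_k: "galois_over_Q k" and kl: "k \<subseteq> l"
    and w0: "w0 \<in> arch_places l"
begin

abbreviation "G \<equiv> aut l \<rat>"
abbreviation "W \<equiv> place_stab l w0"
abbreviation "H \<equiv> aut l k"
abbreviation "P \<equiv> set_prod W H"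

lemma lF: "subfield_C l"
  by (rule galois_subfield[OF gal_l])

lemma kF: "subfield_C k"
  by (rule galois_subfield[OF gal_k])

lemma lN: "number_field l"
  using gal_l by (simp add: galois_over_Q_def)

sublocale G: perm_group G
  by (rule perm_group_aut[OF lN Rats_subset_subfield_C[OF lF] subfield_Rats])

sublocale H: perm_group H
  by (rule perm_group_aut[OF lN kl kF])

lemma H_subset: "H \<subseteq> G"
  by (rule aut_antimono[OF Rats_subset_subfield_C[OF kF]])

lemma W_iff: "g \<in> W \<longleftrightarrow> g \<in> G \<and> (\<forall>x. w0 (inv g x) = w0 x)"
  by (auto simp: place_stab_def place_act_def fun_eq_iff)

lemma W_subset: "W \<subseteq> G"
  using W_iff by blast

sublocale W: perm_group W
proof
  show "finite W"
    using finite_subset[OF W_subset G.fin] .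
  show "id \<in> W"
    by (simp add: W_iff)
  show "a \<circ> b \<in> W" if "a \<in> W" "b \<in> W" for a b
    using that by (simp add: W_iff G.inv_comp)
  show "inv a \<in> W" if "a \<in> W" for a
    using that by (metis W_iff G.inv_mem G.inv_simps(6,7))
  show "bij a" if "a \<in> W" for a
    using that W_subset G.bij_mem by blast
qed

text \<open>An automorphism sends x to another root of a rational polynomial all of whose roots lie
  in k.\<close>

lemma aut_k:
  assumes g: "g \<in> G" and x: "x \<in> k"
  shows "g x \<in> k"
proof -
  obtain p where p: "p \<in> poly_over \<rat>" "poly p x = 0" "\<And>z. poly p z = 0 \<Longrightarrow> z \<in> k"
    using galois_algebraic[OF gal_k x] by blast
  have "poly p (g x) = g (poly p x)"
    using p(1) x kl by (intro aut_poly[symmetric, OF g lF Rats_subset_subfield_C[OF lF]]) (auto simp: poly_over_def)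
  then have "poly p (g x) = 0"
    using p(2) aut_hom(1)[OF g lF] by simp
  then show ?thesis
    using p(3) by blast
qed

text \<open>As g maps k into itself, h fixes g x whenever x is in k. Normality makes W H a group and
  lets the relative norm commute with G.\<close>

lemma H_normal:
  assumes g: "g \<in> G" and h: "h \<in> H"
  shows "inv g \<circ> h \<circ> g \<in> H"
proof -
  have "inv g \<circ> h \<circ> g \<in> G"
    using g h H_subset by auto
  moreover have "(inv g \<circ> h \<circ> g) x = x" if "x \<in> k" for x
    using autD(5)[OF h aut_k[OF g that]] g by simp
  ultimately show ?thesis
    by (simp add: aut_def)
qed

lemma H_normal':
  assumes "g \<in> G" "h \<in> H"
  shows "g \<circ> h \<circ> inv g \<in> H"
  using H_normal[of "inv g" h] assms by simp

lemma P_subset: "P \<subseteq> G"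
  using W_subset H_subset G.comp_mem by (auto simp: set_prod_def subset_iff)

lemma W_subset_P: "W \<subseteq> P"
proof
  fix w assume "w \<in> W"
  moreover have "w = w \<circ> id"
    by simp
  ultimately show "w \<in> P"
    unfolding set_prod_def using H.id_mem by blast
qed

sublocale P: perm_group P
proof
  show "finite P"
    using finite_subset[OF P_subset G.fin] .
  show "id \<in> P"
    using W_subset_P W.id_mem by blast
  show "a \<circ> b \<in> P" if ab: "a \<in> P" "b \<in> P" for a b
  proof -
    obtain w h v j where *: "w \<in> W" "h \<in> H" "v \<in> W" "j \<in> H" "a = w \<circ> h" "b = v \<circ> j"
      using ab by (auto simp: set_prod_def)
    have "v \<in> G"
      using * W_subset by blast
    \<comment> \<open>Normality moves h past v at the price of a conjugation; the formula for
      inverses below uses the same device.\<close>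
    then have "a \<circ> b = (w \<circ> v) \<circ> ((inv v \<circ> h \<circ> v) \<circ> j)"
      using * by (simp add: comp_assoc)
    then show ?thesis
      unfolding set_prod_def using * H_normal[OF \<open>v \<in> G\<close> *(2)] W.comp_mem H.comp_mem by blast
  qed
  show "inv a \<in> P" if a: "a \<in> P" for a
  proof -
    obtain w h where *: "w \<in> W" "h \<in> H" "a = w \<circ> h"
      using a by (auto simp: set_prod_def)
    have G: "w \<in> G" "h \<in> G"
      using * W_subset H_subset by auto
    then have "inv a = inv w \<circ> (w \<circ> inv h \<circ> inv w)"
      using * by (simp add: comp_assoc G.inv_comp)
    then show ?thesis
      unfolding set_prod_def using * H_normal'[OF G(1) H.inv_mem[OF *(2)]] W.inv_mem by blast
  qed
  show "bij a" if "a \<in> P" for a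
    using that P_subset G.bij_mem by blast
qed

lemma card_P_le: "card P \<le> card W * card H"
proof -
  have "P = (\<lambda>(a, b). a \<circ> b) ` (W \<times> H)"
    by (auto simp: set_prod_def)
  then show ?thesis
    using card_image_le[of "W \<times> H" "\<lambda>(a, b). a \<circ> b"] W.fin H.fin
    by (simp add: card_cartesian_product)
qed

lemma w0_hom:
  assumes "x \<in> l" "y \<in> l"
  shows "w0 (x * y) = w0 x * w0 y"
  using w0 by (auto simp: arch_places_def norm_mult autD(4)[OF _ assms])

lemma w0_pos:
  assumes "x \<in> l" "x \<noteq> 0"
  shows "w0 x > 0"
  using w0 by (auto simp: arch_places_def assms aut_hom(3)[OF _ lF])

lemma ln_w0_prod:
  assumes "\<And>i. i \<in> I \<Longrightarrow> x i \<in> l" "\<And>i. i \<in> I \<Longrightarrow> x i \<noteq> 0" "finite I"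
  shows "ln (w0 (\<Prod>i\<in>I. x i powi e i)) = (\<Sum>i\<in>I. of_int (e i) * ln (w0 (x i)))"
proof -
  obtain \<sigma> where \<sigma>: "\<sigma> \<in> G" "w0 = (\<lambda>x. cmod (\<sigma> x))"
    using w0 by (auto simp: arch_places_def)
  have "w0 (\<Prod>i\<in>I. x i powi e i) = cmod (\<Prod>i\<in>I. \<sigma> (x i) powi e i)"
    using assms(1) by (simp add: \<sigma>(2) aut_hom(6,8)[OF \<sigma>(1) lF] subfield_C_D(9)[OF lF])
  also have "\<dots> = (\<Prod>i\<in>I. w0 (x i) powi e i)"
    by (simp add: \<sigma>(2) norm_power_int flip: prod_norm)
  also have "ln \<dots> = (\<Sum>i\<in>I. ln (w0 (x i) powi e i))"
    using assms w0_pos by (intro ln_prod) (force simp: zero_less_power_int)+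
  also have "\<dots> = (\<Sum>i\<in>I. of_int (e i) * ln (w0 (x i)))"
  proof (intro sum.cong refl)
    fix i assume "i \<in> I"
    then have "w0 (x i) > 0"
      using assms w0_pos by blast
    then show "ln (w0 (x i) powi e i) = of_int (e i) * ln (w0 (x i))"
      by (simp add: ln_powr flip: powr_real_of_int')
  qed
  finally show ?thesis .
qed

end

section \<open>Independence of the relative units\<close>

lemma (in galois_tower) apply_mem: "\<lbrakk>g \<in> G; x \<in> l\<rbrakk> \<Longrightarrow> g x \<in> l"
  using autD(2) by blast

text \<open>Conjugation by g permutes H, and g \<circ> h = (g \<circ> h \<circ> inv g) \<circ>
  g.\<close>

lemma (in galois_tower) rel_norm_equivariant:
  assumes g: "g \<in> G" and x: "x \<in> l"
  shows "rel_norm l k (g x) = g (rel_norm l k x)"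
proof -
  have "g (rel_norm l k x) = (\<Prod>h\<in>H. g (h x))"
    unfolding rel_norm_def using H_subset apply_mem x by (intro aut_hom(8)[OF g lF]) blast
  also have "\<dots> = (\<Prod>h\<in>H. h (g x))"
    by (rule prod.reindex_bij_witness[where j = "\<lambda>h. g \<circ> h \<circ> inv g" and i = "\<lambda>h. inv g \<circ> h \<circ> g"])
      (use g H_normal H_normal' in \<open>simp_all add: comp_assoc\<close>)
  finally show ?thesis
    by (simp add: rel_norm_def)
qed

lemma (in galois_tower) rel_norm_H:
  assumes "h \<in> H"
  shows "rel_norm l k (h x) = rel_norm l k x"
  unfolding rel_norm_def
  by (rule prod.reindex_bij_witness[where j = "\<lambda>g. g \<circ> h" and i = "\<lambda>g. g \<circ> inv h"])
    (use assms in \<open>simp_all add: comp_assoc\<close>)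

section \<open>The weight \<lambda>, its sums, and the composed transversal\<close>

locale transversal_data = galois_tower +
  fixes Psi T S :: "cauto set" and Jsel :: "cauto \<Rightarrow> cauto set" and lam :: "cauto \<Rightarrow> int"
  assumes Psi: "left_transversal G W Psi"
    and T: "left_transversal G P T"
    and S: "left_transversal P W S"
    and Jsel: "\<forall>\<tau>\<in>T. Jsel \<tau> \<subseteq> S \<and> card (Jsel \<tau>) = card P div card W - 1"
    and lam: "\<forall>g. lam g = (if g \<in> W then int (card P div card W) - 1 else if g \<in> P then -1 else 0)"
begin

text \<open>Lagrange's theorem for W in P, which shows that the truncating \<open>div\<close> in
  \<open>Jsel\<close> and \<open>lam\<close> is exact.\<close>

lemma card_P: "card P = card S * card W"
  using transversal_sum[OF P.perm_group_axioms W.perm_group_axioms W_subset_P S, of "\<lambda>_. 1 :: nat"]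
  by simp

abbreviation "J \<equiv> card S"

lemma J: "card P div card W = J" "J > 0"
  using W.card_pos P.card_pos card_P by auto

lemma J_le: "J \<le> fdeg k l"
proof -
  have "J * card W \<le> card H * card W"
    using card_P card_P_le by (simp add: mult.commute)
  then have "J \<le> card H"
    using W.card_pos by simp
  also have "\<dots> \<le> fdeg k l"
    by (rule card_aut_le_fdeg[OF lN kl kF])
  finally show ?thesis .
qed

text \<open>As a combination of indicator functions of two groups containing W, \<lambda> is visibly
  W-invariant on both sides, and its sums over G reduce to group orders.\<close>

lemma lam_eq: "lam g = int J * of_bool (g \<in> W) - of_bool (g \<in> P)"
  using lam W_subset_P J(1) by auto

lemma lam_right: "\<lbrakk>g \<in> G; w \<in> W\<rbrakk> \<Longrightarrow> lam (g \<circ> w) = lam g"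
proof -
  assume g: "g \<in> G" "w \<in> W"
  then have "g = (g \<circ> w) \<circ> inv w" "w \<in> P"
    using W_subset W_subset_P by (auto simp: comp_assoc)
  then have "g \<circ> w \<in> W \<longleftrightarrow> g \<in> W" "g \<circ> w \<in> P \<longleftrightarrow> g \<in> P"
    using g(2) W.comp_mem W.inv_mem P.comp_mem P.inv_mem by metis+
  then show ?thesis
    by (simp add: lam_eq)
qed

lemma lam_left: "\<lbrakk>g \<in> G; w \<in> W\<rbrakk> \<Longrightarrow> lam (w \<circ> g) = lam g"
proof -
  assume g: "g \<in> G" "w \<in> W"
  then have "g = inv w \<circ> (w \<circ> g)" "w \<in> P"
    using W_subset W_subset_P by auto
  then have "w \<circ> g \<in> W \<longleftrightarrow> g \<in> W" "w \<circ> g \<in> P \<longleftrightarrow> g \<in> P"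
    using g(2) W.comp_mem W.inv_mem P.comp_mem P.inv_mem by metis+
  then show ?thesis
    by (simp add: lam_eq)
qed

lemma sum_of_bool:
  assumes "Q \<subseteq> G"
  shows "(\<Sum>g\<in>G. of_bool (g \<in> Q)) = int (card Q)"
  using assms G.fin by (simp add: of_bool_def sum.If_cases Int_absorb1)

lemma Psi_subset: "Psi \<subseteq> G"
  using Psi by (simp add: left_transversal_def)

lemma Psi_fin: "finite Psi"
  using finite_subset[OF Psi_subset G.fin] .

lemma sum_lam: "(\<Sum>\<psi>\<in>Psi. lam \<psi>) = 0"
proof -
  have "int (card W) * (\<Sum>\<psi>\<in>Psi. lam \<psi>) = (\<Sum>g\<in>G. lam g)"
    using transversal_sum[OF G.perm_group_axioms W.perm_group_axioms W_subset Psi, of lam] lam_right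
    by simp
  also have "\<dots> = int J * (\<Sum>g\<in>G. of_bool (g \<in> W)) - (\<Sum>g\<in>G. of_bool (g \<in> P))"
    by (simp only: lam_eq sum_subtractf sum_distrib_left)
  also have "\<dots> = 0"
    by (simp add: sum_of_bool W_subset P_subset card_P)
  finally show ?thesis
    using W.card_pos by simp
qed

lemma sum_abs_lam: "(\<Sum>\<psi>\<in>Psi. \<bar>lam \<psi>\<bar>) = 2 * (int J - 1)"
proof -
  \<comment> \<open>On W the value is (J - 2) + 1 = J - 1, nonnegative because J > 0; on the rest of
    P it is 1. Summed over G this gives (J - 2) \<open>card W\<close> + J \<open>card W\<close>, the
    origin of the constant 2 (J - 1).\<close>
  have abs: "\<bar>lam g\<bar> = (int J - 2) * of_bool (g \<in> W) + of_bool (g \<in> P)" for g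
    using W_subset_P J(2) by (auto simp: lam_eq)
  have "int (card W) * (\<Sum>\<psi>\<in>Psi. \<bar>lam \<psi>\<bar>) = (\<Sum>g\<in>G. \<bar>lam g\<bar>)"
    using transversal_sum[OF G.perm_group_axioms W.perm_group_axioms W_subset Psi, of "\<lambda>g. \<bar>lam g\<bar>"] lam_right
    by simp
  also have "\<dots> = (int J - 2) * (\<Sum>g\<in>G. of_bool (g \<in> W)) + (\<Sum>g\<in>G. of_bool (g \<in> P))"
    by (simp only: abs sum.distrib sum_distrib_left)
  also have "\<dots> = int (card W) * (2 * (int J - 1))"
    by (simp add: sum_of_bool W_subset P_subset card_P algebra_simps)
  finally show ?thesis
    using W.card_pos by simp
qed

text \<open>The products \<tau> \<circ> \<sigma> represent distinct cosets of W in G: the coset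
  modulo P determines \<tau>, and after cancelling \<tau> the coset modulo W determines \<sigma>.
  Exponents of a relation can therefore be read off from a function on G/W.\<close>

lemma transversal_pair_unique:
  assumes "\<tau> \<in> T" "\<tau>' \<in> T" "\<sigma> \<in> S" "\<sigma>' \<in> S" "\<tau> \<circ> \<sigma> \<in> lcoset (\<tau>' \<circ> \<sigma>') W"
  shows "\<tau> = \<tau>' \<and> \<sigma> = \<sigma>'"
proof -
  obtain w where w: "w \<in> W" "\<tau> \<circ> \<sigma> = \<tau>' \<circ> \<sigma>' \<circ> w"
    using assms(5) by (auto simp: lcoset_def)
  have mem: "\<tau> \<in> G" "\<tau>' \<in> G" "\<sigma> \<in> P" "\<sigma>' \<in> P" "w \<in> P"
    using assms T S w(1) W_subset_P by (auto simp: left_transversal_def)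
  have "\<tau> = \<tau> \<circ> \<sigma> \<circ> inv \<sigma>"
    using mem by (simp add: comp_assoc)
  also have "\<dots> = \<tau>' \<circ> (\<sigma>' \<circ> w \<circ> inv \<sigma>)"
    by (simp add: w(2) comp_assoc)
  finally have "\<tau> \<in> lcoset \<tau>' P"
    unfolding lcoset_def using mem P.comp_mem P.inv_mem by (metis image_eqI)
  moreover have "\<tau>' \<in> lcoset \<tau>' P"
    unfolding lcoset_def using P.id_mem by (metis comp_id image_eqI)
  ultimately have \<tau>: "\<tau> = \<tau>'"
    using T assms(1,2) mem(2) unfolding left_transversal_def by blast
  have "\<sigma> = inv \<tau>' \<circ> (\<tau>' \<circ> \<sigma>)"
    using mem by simp
  also have "\<tau>' \<circ> \<sigma> = \<tau>' \<circ> (\<sigma>' \<circ> w)"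
    using w(2) \<tau> by (simp add: comp_assoc)
  also have "inv \<tau>' \<circ> (\<tau>' \<circ> (\<sigma>' \<circ> w)) = \<sigma>' \<circ> w"
    using mem by simp
  finally have "\<sigma> \<in> lcoset \<sigma>' W"
    unfolding lcoset_def using w by blast
  moreover have "\<sigma>' \<in> lcoset \<sigma>' W"
    unfolding lcoset_def using W.id_mem by (metis comp_id image_eqI)
  ultimately have "\<sigma> = \<sigma>'"
    using S assms(3,4) mem(4) unfolding left_transversal_def by blast
  then show ?thesis
    using \<tau> by blast
qed

end

text \<open>The common setting of both parts. Stability makes \<open>A\<close> left invariant under
  W, so that sums over \<open>Psi\<close> can be traded for sums over G.\<close>

locale stable_unit = transversal_data +
  fixes \<alpha> :: complex
  assumes unit: "\<alpha> \<in> units_of_int l"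
    and stable: "\<And>w. w \<in> W \<Longrightarrow> w \<alpha> = \<alpha>"
begin

abbreviation "D \<equiv> Delta Psi \<alpha> lam"

lemma \<alpha>_mem: "\<alpha> \<in> l" "\<alpha> \<noteq> 0"
  using unit by (auto simp: units_of_int_def)

lemma D_unit: "D \<in> units_of_int l"
  unfolding Delta_def using Psi_subset units_of_int_aut[OF _ lF unit]
  by (intro units_of_int_prod[OF lF] units_of_int_powi[OF lF]) blast

lemma apply_D:
  assumes g: "g \<in> G"
  shows "g D = (\<Prod>\<psi>\<in>Psi. (g \<circ> \<psi>) \<alpha> powi lam \<psi>)"
proof -
  have "\<psi> \<alpha> \<in> l" if "\<psi> \<in> Psi" for \<psi>
    using that Psi_subset apply_mem \<alpha>_mem by blast
  then show ?thesis
    unfolding Delta_def by (simp add: aut_hom(6,8)[OF g lF] subfield_C_D(9)[OF lF])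
qed

text \<open>For \<psi> = w \<circ> h the norm absorbs h, and w passes through the norm to reach
  \<alpha>, which it fixes.\<close>

lemma rel_norm_P:
  assumes "\<psi> \<in> P"
  shows "rel_norm l k (\<psi> \<alpha>) = rel_norm l k \<alpha>"
proof -
  obtain w h where wh: "w \<in> W" "h \<in> H" "\<psi> = w \<circ> h"
    using assms by (auto simp: set_prod_def)
  then have mem: "w \<in> G" "h \<alpha> \<in> l"
    using W_subset H_subset apply_mem \<alpha>_mem(1) by auto
  have "rel_norm l k (\<psi> \<alpha>) = w (rel_norm l k (h \<alpha>))"
    using rel_norm_equivariant[OF mem] by (simp add: wh(3))
  also have "\<dots> = rel_norm l k (w \<alpha>)"
    using rel_norm_H[OF wh(2)] rel_norm_equivariant[OF mem(1) \<alpha>_mem(1)] by simp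
  finally show ?thesis
    by (simp add: stable[OF wh(1)])
qed

lemma rel_norm_D: "rel_norm l k D = 1"
proof -
  have nz: "rel_norm l k \<alpha> \<noteq> 0"
    unfolding rel_norm_def using H.fin H_subset \<alpha>_mem by (auto simp: aut_hom(3)[OF _ lF])
  have "rel_norm l k D = (\<Prod>h\<in>H. \<Prod>\<psi>\<in>Psi. h (\<psi> \<alpha>) powi lam \<psi>)"
    unfolding rel_norm_def using H_subset by (intro prod.cong refl) (auto simp: apply_D)
  also have "\<dots> = (\<Prod>\<psi>\<in>Psi. rel_norm l k (\<psi> \<alpha>) powi lam \<psi>)"
    unfolding rel_norm_def prod_powi by (rule prod.swap)
  \<comment> \<open>On P the norms of the conjugates agree; off P they may differ, but the exponent
    is 0 there.\<close>
  also have "\<dots> = (\<Prod>\<psi>\<in>Psi. rel_norm l k \<alpha> powi lam \<psi>)"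
  proof (intro prod.cong refl)
    fix \<psi>
    show "rel_norm l k (\<psi> \<alpha>) powi lam \<psi> = rel_norm l k \<alpha> powi lam \<psi>"
      using W_subset_P by (cases "\<psi> \<in> P") (auto simp: rel_norm_P lam_eq)
  qed
  also have "\<dots> = 1"
    by (simp add: sum_lam flip: powi_sum[OF nz])
  finally show ?thesis .
qed

lemma rel_unit_D:
  assumes "g \<in> G"
  shows "rel_unit l k (g D)"
proof -
  have "D \<in> l"
    using D_unit by (simp add: units_of_int_def)
  then have "rel_norm l k (g D) = 1"
    using rel_norm_equivariant[OF assms] rel_norm_D aut_hom(2)[OF assms lF] by simp
  then have "root_of_unity (rel_norm l k (g D))"
    by (auto simp: root_of_unity_def)
  then show ?thesis
    using units_of_int_aut[OF assms lF D_unit] by (simp add: rel_unit_def)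
qed

definition A :: "cauto \<Rightarrow> real" where
  "A = (\<lambda>g. ln (w0 (inv g \<alpha>)))"

lemma A_left:
  assumes "w \<in> W" "g \<in> G"
  shows "A (inv w \<circ> g) = A g"
proof -
  have "w \<in> G"
    using assms W_subset by blast
  then show ?thesis
    using assms by (simp add: A_def G.inv_comp stable)
qed

lemma sum_A: "(\<Sum>g\<in>G. A g) = 0"
proof -
  obtain \<sigma> where \<sigma>: "\<sigma> \<in> G" "w0 = (\<lambda>x. cmod (\<sigma> x))"
    using w0 by (auto simp: arch_places_def)
  have "(\<Sum>g\<in>G. A g) = (\<Sum>g\<in>G. ln (cmod ((\<sigma> \<circ> g) \<alpha>)))"
    unfolding A_def unfolding \<sigma>(2) using G.sum_inv[of "\<lambda>g. ln (cmod ((\<sigma> \<circ> g) \<alpha>))"] by simp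
  also have "\<dots> = 0"
    using G.sum_left[OF \<sigma>(1), of "\<lambda>g. ln (cmod (g \<alpha>))"] product_formula[OF gal_l unit] by simp
  finally show ?thesis .
qed

text \<open>This identifies the inner sum in the hypothesis \<open>rel\<close> of
  \<open>convolution_kernel\<close>: up to the factor \<open>card W\<close>, it is the logarithm of
  g(D) at the place h \<open>w0\<close>.\<close>

lemma ln_w0_D:
  assumes "g \<in> G" "h \<in> G"
  shows "(\<Sum>x\<in>G. of_int (lam x) * A (inv x \<circ> inv g \<circ> h)) = real (card W) * ln (w0 (inv h (g D)))"
proof -
  have "(\<Sum>x\<in>G. of_int (lam x) * A (inv x \<circ> inv g \<circ> h)) =
      real (card W) * (\<Sum>\<psi>\<in>Psi. of_int (lam \<psi>) * A (inv \<psi> \<circ> inv g \<circ> h))"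
  proof (rule transversal_sum[OF G.perm_group_axioms W.perm_group_axioms W_subset Psi])
    fix x w assume xw: "x \<in> G" "w \<in> W"
    then have "w \<in> G"
      using W_subset by blast
    then have "inv (x \<circ> w) \<circ> inv g \<circ> h = inv w \<circ> (inv x \<circ> inv g \<circ> h)"
      using xw by (simp add: G.inv_comp comp_assoc)
    then show "of_int (lam (x \<circ> w)) * A (inv (x \<circ> w) \<circ> inv g \<circ> h) =
        of_int (lam x) * A (inv x \<circ> inv g \<circ> h)"
      using A_left xw assms by (simp add: lam_right)
  qed
  also have "(\<Sum>\<psi>\<in>Psi. of_int (lam \<psi>) * A (inv \<psi> \<circ> inv g \<circ> h)) =
      (\<Sum>\<psi>\<in>Psi. of_int (lam \<psi>) * ln (w0 ((inv h \<circ> g \<circ> \<psi>) \<alpha>)))"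
    using Psi_subset assms by (intro sum.cong refl) (auto simp: A_def G.inv_comp subset_iff)
  also have "\<dots> = ln (w0 (\<Prod>\<psi>\<in>Psi. (inv h \<circ> g \<circ> \<psi>) \<alpha> powi lam \<psi>))"
  proof (rule ln_w0_prod[symmetric])
    fix \<psi> assume "\<psi> \<in> Psi"
    then have m: "inv h \<circ> g \<circ> \<psi> \<in> G"
      using assms Psi_subset by auto
    show "(inv h \<circ> g \<circ> \<psi>) \<alpha> \<in> l" "(inv h \<circ> g \<circ> \<psi>) \<alpha> \<noteq> 0"
      using apply_mem[OF m \<alpha>_mem(1)] aut_hom(3)[OF m lF \<alpha>_mem(1)] \<alpha>_mem(2) by auto
  qed (rule Psi_fin)
  also have "\<dots> = ln (w0 (inv h (g D)))"
    using apply_D[of "inv h \<circ> g"] assms by simp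
  finally show ?thesis .
qed

lemma mult_indep_D:
  assumes neg: "\<And>g. \<lbrakk>g \<in> G; g \<notin> W\<rbrakk> \<Longrightarrow> A g < 0"
  shows "mult_indep {(\<tau>, \<sigma>). \<tau> \<in> T \<and> \<sigma> \<in> Jsel \<tau>} (\<lambda>(\<tau>, \<sigma>). (\<tau> \<circ> \<sigma>) D)"
  unfolding mult_indep_def
proof (intro allI impI)
  fix e :: "cauto \<times> cauto \<Rightarrow> int"
  define I where "I = {(\<tau>, \<sigma>). \<tau> \<in> T \<and> \<sigma> \<in> Jsel \<tau>}"
  define q :: "cauto \<times> cauto \<Rightarrow> cauto" where "q = (\<lambda>(\<tau>, \<sigma>). \<tau> \<circ> \<sigma>)"
  define Z where "Z = (\<Prod>i\<in>I. q i D powi e i)"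
  assume "root_of_unity (\<Prod>p\<in>I. (case p of (\<tau>, \<sigma>) \<Rightarrow> (\<tau> \<circ> \<sigma>) D) powi e p)"
    (is "root_of_unity ?Z")
  moreover have "?Z = Z"
    unfolding Z_def q_def by (intro prod.cong) auto
  ultimately have Z: "root_of_unity Z"
    by simp
  have sub: "T \<subseteq> G" "S \<subseteq> P" "\<And>\<tau>. \<tau> \<in> T \<Longrightarrow> Jsel \<tau> \<subseteq> S"
    using T S Jsel by (auto simp: left_transversal_def)
  have "I \<subseteq> T \<times> S"
    using sub(3) by (auto simp: I_def)
  moreover have "finite (T \<times> S)"
    using finite_subset[OF sub(1) G.fin] finite_subset[OF sub(2) P.fin] by simp
  ultimately have finI: "finite I"
    by (rule finite_subset)
  have qG: "q i \<in> G" if "i \<in> I" for i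
  proof -
    have "fst i \<in> T" "snd i \<in> Jsel (fst i)" "q i = fst i \<circ> snd i"
      using that by (auto simp: I_def q_def)
    then have "fst i \<in> G" "snd i \<in> G" "q i = fst i \<circ> snd i"
      using sub P_subset by blast+
    then show ?thesis
      by simp
  qed
  have D: "D \<in> l" "D \<noteq> 0"
    using D_unit by (auto simp: units_of_int_def)
  have qD: "g (q i D) \<in> l" "g (q i D) \<noteq> 0" "q i D \<in> l" if "i \<in> I" "g \<in> G" for g i
    using D qG[OF that(1)] that(2) apply_mem aut_hom(3)[OF _ lF] by metis+
  \<comment> \<open>A root of unity has absolute value 1 at every archimedean place, so the
    multiplicative relation becomes one linear relation for each h.\<close>
  have ZI: "(\<Sum>i\<in>I. of_int (e i) * ln (w0 (inv h (q i D)))) = 0" if h: "h \<in> G" for h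
  proof -
    note ih = G.inv_mem[OF h]
    have "(\<Sum>i\<in>I. of_int (e i) * ln (w0 (inv h (q i D)))) = ln (w0 (\<Prod>i\<in>I. inv h (q i D) powi e i))"
      using qD[OF _ ih] finI by (intro ln_w0_prod[symmetric]) auto
    also have "(\<Prod>i\<in>I. inv h (q i D) powi e i) = inv h Z"
      unfolding Z_def using qD(3)[OF _ ih]
      by (simp add: aut_hom(6,8)[OF ih lF] subfield_C_D(9)[OF lF])
    also have "w0 (inv h Z) = 1"
    proof -
      obtain n where n: "n > 0" "Z ^ n = 1"
        using Z by (auto simp: root_of_unity_def)
      obtain \<sigma> where \<sigma>: "\<sigma> \<in> G" "w0 = (\<lambda>x. cmod (\<sigma> x))"
        using w0 by (auto simp: arch_places_def)
      have m: "\<sigma> \<circ> inv h \<in> G"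
        using \<sigma>(1) ih by simp
      have ZL: "Z \<in> l"
        unfolding Z_def using qD(3)[OF _ ih] by (intro subfield_C_D(11)[OF lF] subfield_C_D(9)[OF lF])
      have "((\<sigma> \<circ> inv h) Z) ^ n = 1"
        using aut_hom(5)[OF m lF ZL, of n] aut_hom(2)[OF m lF] n(2) by simp
      then have "cmod ((\<sigma> \<circ> inv h) Z) ^ n = 1"
        by (metis norm_one norm_power)
      then have "cmod ((\<sigma> \<circ> inv h) Z) = 1"
        using power_eq_iff_eq_base[OF n(1), of "cmod ((\<sigma> \<circ> inv h) Z)" 1] by simp
      then show ?thesis
        by (simp add: \<sigma>(2))
    qed
    finally show ?thesis
      by simp
  qed
  \<comment> \<open>The exponents are spread over the cosets q(i) W, turning a family indexed by
    pairs into a function on G/W.\<close>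
  define f :: "cauto \<Rightarrow> real" where
    "f = (\<lambda>g. \<Sum>i\<in>I. of_int (e i) * of_bool (g \<in> lcoset (q i) W))"
  have f_inv: "f (g \<circ> w) = f g" if gw: "g \<in> G" "w \<in> W" for g w
  proof -
    have "g \<circ> w \<in> lcoset x W \<longleftrightarrow> g \<in> lcoset x W" for x
    proof
      assume "g \<circ> w \<in> lcoset x W"
      then obtain v where v: "v \<in> W" "g \<circ> w = x \<circ> v"
        by (auto simp: lcoset_def)
      have "g = (g \<circ> w) \<circ> inv w"
        using gw by (simp add: comp_assoc)
      also have "\<dots> = x \<circ> (v \<circ> inv w)"
        by (simp add: v(2) comp_assoc)
      finally show "g \<in> lcoset x W"
        unfolding lcoset_def using v(1) gw W.comp_mem W.inv_mem by (metis image_eqI)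
    next
      assume "g \<in> lcoset x W"
      then obtain v where "v \<in> W" "g = x \<circ> v"
        by (auto simp: lcoset_def)
      then show "g \<circ> w \<in> lcoset x W"
        unfolding lcoset_def using gw W.comp_mem by (metis image_eqI comp_assoc)
    qed
    then show ?thesis
      by (simp add: f_def)
  qed
  have const: "f (y \<circ> p) = f y" if y: "y \<in> G" "p \<in> P" for y p
  proof (rule convolution_kernel[where lam = "\<lambda>g. of_int (lam g)" and J = "real J" and A = A and f = f,
        OF G.perm_group_axioms P.perm_group_axioms W.perm_group_axioms W_subset_P P_subset])
    show "real (card P) = real J * real (card W)"
      by (simp add: card_P)
    show "of_int (lam g) = real J * of_bool (g \<in> W) - of_bool (g \<in> P)" for g
      by (simp add: lam_eq)
    fix h assume h: "h \<in> G"
    define B where "B = (\<lambda>g. real (card W) * ln (w0 (inv h (g D))))"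
    \<comment> \<open>Replacing x by w \<circ> x moves w from g onto \<lambda>; thus right
      invariance of B under W is left invariance of \<lambda>.\<close>
    have B_inv: "B (g \<circ> w) = B g" if gw: "g \<in> G" "w \<in> W" for g w
    proof -
      have wG: "w \<in> G"
        using gw W_subset by blast
      have "B (g \<circ> w) = (\<Sum>x\<in>G. of_int (lam x) * A (inv x \<circ> inv (g \<circ> w) \<circ> h))"
        using ln_w0_D[of "g \<circ> w" h] gw wG h by (simp add: B_def)
      also have "\<dots> = (\<Sum>x\<in>G. of_int (lam (w \<circ> x)) * A (inv (w \<circ> x) \<circ> inv g \<circ> h))"
        using gw wG by (intro sum.cong refl) (simp add: G.inv_comp comp_assoc lam_left)
      also have "\<dots> = (\<Sum>x\<in>G. of_int (lam x) * A (inv x \<circ> inv g \<circ> h))"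
        by (rule G.sum_left[OF wG])
      also have "\<dots> = B g"
        unfolding B_def by (rule ln_w0_D[OF gw(1) h])
      finally show ?thesis .
    qed
    have coset: "(\<Sum>g\<in>G. of_bool (g \<in> lcoset x W) * B g) = real (card W) * B x" if x: "x \<in> G" for x
    proof -
      have "lcoset x W \<subseteq> G"
        using x W_subset by (auto simp: lcoset_def)
      then have "(\<Sum>g\<in>G. of_bool (g \<in> lcoset x W) * B g) = sum B (lcoset x W)"
        using G.fin by (intro sum.mono_neutral_cong_right) auto
      also have "\<dots> = (\<Sum>w\<in>W. B (x \<circ> w))"
        unfolding lcoset_def
      proof (subst sum.reindex)
        show "inj_on (\<lambda>h. x \<circ> h) W"
          by (rule inj_on_inverseI[of _ "\<lambda>g. inv x \<circ> g"]) (use x in simp)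
      qed simp
      also have "\<dots> = real (card W) * B x"
        using B_inv[OF x] by simp
      finally show ?thesis .
    qed
    have "(\<Sum>g\<in>G. f g * (\<Sum>x\<in>G. of_int (lam x) * A (inv x \<circ> inv g \<circ> h))) = (\<Sum>g\<in>G. f g * B g)"
      unfolding B_def using ln_w0_D h by (intro sum.cong refl) simp
    also have "\<dots> = (\<Sum>i\<in>I. of_int (e i) * (\<Sum>g\<in>G. of_bool (g \<in> lcoset (q i) W) * B g))"
      unfolding f_def sum_distrib_right sum_distrib_left by (subst sum.swap) (simp only: mult.assoc)
    also have "\<dots> = (\<Sum>i\<in>I. real (card W) * real (card W) * (of_int (e i) * ln (w0 (inv h (q i D)))))"
      using coset[OF qG] by (intro sum.cong refl) (simp add: B_def)
    also have "\<dots> = 0"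
      unfolding sum_distrib_left[symmetric] ZI[OF h] by simp
    finally show "(\<Sum>g\<in>G. f g * (\<Sum>x\<in>G. of_int (lam x) * A (inv x \<circ> inv g \<circ> h))) = 0" .
  qed (fact neg sum_A f_inv y)+
  have f_eq: "f (\<tau> \<circ> s) = (if s \<in> Jsel \<tau> then of_int (e (\<tau>, s)) else 0)" if "\<tau> \<in> T" "s \<in> S" for \<tau> s
  proof -
    have self: "\<tau> \<circ> s \<in> lcoset (\<tau> \<circ> s) W"
      unfolding lcoset_def using W.id_mem by (metis comp_id image_eqI)
    have "\<tau> \<circ> s \<in> lcoset (q i) W \<longleftrightarrow> i = (\<tau>, s)" if i: "i \<in> I" for i
    proof -
      obtain \<tau>' s' where i': "i = (\<tau>', s')" "\<tau>' \<in> T" "s' \<in> S"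
        using i sub(3) by (auto simp: I_def)
      show ?thesis
        using transversal_pair_unique[OF \<open>\<tau> \<in> T\<close> i'(2) \<open>s \<in> S\<close> i'(3)] self by (auto simp: i'(1) q_def)
    qed
    then have "f (\<tau> \<circ> s) = (\<Sum>i\<in>I. if i = (\<tau>, s) then of_int (e i) else 0)"
      unfolding f_def by (intro sum.cong refl) auto
    also have "\<dots> = (if (\<tau>, s) \<in> I then of_int (e (\<tau>, s)) else 0)"
      using finI by simp
    finally show ?thesis
      using that by (simp add: I_def)
  qed
  show "\<forall>p\<in>I. e p = 0"
  proof
    fix p assume "p \<in> I"
    then obtain \<tau> \<sigma> where p: "p = (\<tau>, \<sigma>)" "\<tau> \<in> T" "\<sigma> \<in> Jsel \<tau>"
      by (auto simp: I_def)
    \<comment> \<open>Because J > 0, the truncated difference J - 1 is smaller than J, so some s is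
      omitted. There f vanishes, and f is constant on the coset \<tau> P, which contains both \<tau>
      \<circ> s and \<tau> \<circ> \<sigma>.\<close>
    have "card (Jsel \<tau>) < card S"
      using Jsel p(2) J by auto
    then obtain s where s: "s \<in> S" "s \<notin> Jsel \<tau>"
      using sub(3)[OF p(2)] by (metis less_irrefl subsetI subset_antisym)
    have mem: "\<tau> \<in> G" "s \<in> P" "\<sigma> \<in> P" "\<sigma> \<in> S"
      using p s sub by auto
    have "\<tau> \<circ> \<sigma> = (\<tau> \<circ> s) \<circ> (inv s \<circ> \<sigma>)"
      using mem by (simp add: comp_assoc)
    then have "f (\<tau> \<circ> \<sigma>) = f (\<tau> \<circ> s)"
      using const[of "\<tau> \<circ> s" "inv s \<circ> \<sigma>"] mem P_subset by auto
    then show "e p = 0"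
      using f_eq[OF p(2) mem(4)] f_eq[OF p(2) s(1)] p s(2) by simp
  qed
qed

end

section \<open>Heights\<close>

text \<open>If \<tau> and g give the same place, \<tau> \<circ> inv g preserves the complex absolute
  value; conjugation by s, where \<open>w0\<close> is the absolute value composed with s, carries
  the group of such elements onto W.\<close>

lemma (in galois_tower) card_place_fibre:
  assumes g: "g \<in> G"
  shows "card {\<tau> \<in> G. (\<lambda>x. cmod (\<tau> x)) = (\<lambda>x. cmod (g x))} = card W"
proof -
  obtain s where s: "s \<in> G" "w0 = (\<lambda>x. cmod (s x))"
    using w0 by (auto simp: arch_places_def)
  have "bij_betw (\<lambda>\<tau>. inv s \<circ> g \<circ> inv \<tau> \<circ> s) {\<tau> \<in> G. (\<lambda>x. cmod (\<tau> x)) = (\<lambda>x. cmod (g x))} W"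
  proof (rule bij_betwI[where g = "\<lambda>w. s \<circ> inv w \<circ> inv s \<circ> g"])
    show "(\<lambda>\<tau>. inv s \<circ> g \<circ> inv \<tau> \<circ> s) \<in> {\<tau> \<in> G. (\<lambda>x. cmod (\<tau> x)) = (\<lambda>x. cmod (g x))} \<rightarrow> W"
    proof
      fix \<tau> assume "\<tau> \<in> {\<tau> \<in> G. (\<lambda>x. cmod (\<tau> x)) = (\<lambda>x. cmod (g x))}"
      then have \<tau>: "\<tau> \<in> G" "\<And>x. cmod (\<tau> x) = cmod (g x)"
        by (auto simp: fun_eq_iff)
      have "w0 (inv (inv s \<circ> g \<circ> inv \<tau> \<circ> s) x) = w0 x" for x
        using s(1) g \<tau> by (simp add: s(2) G.inv_comp)
      then show "inv s \<circ> g \<circ> inv \<tau> \<circ> s \<in> W"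
        using s(1) g \<tau>(1) by (simp add: W_iff)
    qed
    show "(\<lambda>w. s \<circ> inv w \<circ> inv s \<circ> g) \<in> W \<rightarrow> {\<tau> \<in> G. (\<lambda>x. cmod (\<tau> x)) = (\<lambda>x. cmod (g x))}"
    proof
      fix w assume "w \<in> W"
      then have w: "w \<in> G" "\<And>x. cmod (s (inv w x)) = cmod (s x)"
        unfolding W_iff by (simp_all add: s(2))
      then show "s \<circ> inv w \<circ> inv s \<circ> g \<in> {\<tau> \<in> G. (\<lambda>x. cmod (\<tau> x)) = (\<lambda>x. cmod (g x))}"
        using s(1) g by simp
    qed
  next
    fix \<tau> assume "\<tau> \<in> {\<tau> \<in> G. (\<lambda>x. cmod (\<tau> x)) = (\<lambda>x. cmod (g x))}"
    then have "\<tau> \<in> G"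
      by auto
    then show "s \<circ> inv (inv s \<circ> g \<circ> inv \<tau> \<circ> s) \<circ> inv s \<circ> g = \<tau>"
      using s(1) g by (simp add: G.inv_comp comp_assoc)
  next
    fix w assume "w \<in> W"
    then have "w \<in> G"
      using W_subset by blast
    then show "inv s \<circ> g \<circ> inv (s \<circ> inv w \<circ> inv s \<circ> g) \<circ> s = w"
      using s(1) g by (simp add: G.inv_comp comp_assoc)
  qed
  then show ?thesis
    by (rule bij_betw_same_card)
qed

text \<open>Each place arises from \<open>card W\<close> automorphisms, and a constant local degree
  comes out of the sum. In this form translation by an element of G leaves the height visibly
  unchanged.\<close>

lemma (in galois_tower) unit_height_eq:
  assumes deg: "\<And>w. w \<in> arch_places l \<Longrightarrow> loc_deg l w = c"
  shows "unit_height l x =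
    real c / real (fdeg \<rat> l) / real (card W) * (\<Sum>\<sigma>\<in>G. max 0 (ln (cmod (\<sigma> x))))"
proof -
  let ?pl = "\<lambda>\<sigma> x. cmod (\<sigma> x)"
  have places: "arch_places l = ?pl ` G"
    by (auto simp: arch_places_def)
  have "(\<Sum>\<sigma>\<in>G. max 0 (ln (cmod (\<sigma> x)))) =
      (\<Sum>w\<in>?pl ` G. \<Sum>\<sigma> | \<sigma> \<in> G \<and> ?pl \<sigma> = w. max 0 (ln (cmod (\<sigma> x))))"
    by (rule sum.image_gen[OF G.fin])
  also have "\<dots> = (\<Sum>w\<in>?pl ` G. real (card W) * max 0 (ln (w x)))"
  proof (intro sum.cong refl)
    fix w assume "w \<in> ?pl ` G"
    then obtain g where g: "g \<in> G" "w = ?pl g"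
      by blast
    have "(\<Sum>\<sigma> | \<sigma> \<in> G \<and> ?pl \<sigma> = w. max 0 (ln (cmod (\<sigma> x)))) =
        (\<Sum>\<sigma> | \<sigma> \<in> G \<and> ?pl \<sigma> = w. max 0 (ln (w x)))"
      by (intro sum.cong refl) auto
    then show "(\<Sum>\<sigma> | \<sigma> \<in> G \<and> ?pl \<sigma> = w. max 0 (ln (cmod (\<sigma> x)))) = real (card W) * max 0 (ln (w x))"
      using card_place_fibre[OF g(1)] g(2) by simp
  qed
  finally have sum: "(\<Sum>\<sigma>\<in>G. max 0 (ln (cmod (\<sigma> x)))) = real (card W) * (\<Sum>w\<in>arch_places l. max 0 (ln (w x)))"
    by (simp add: places sum_distrib_left)
  define r where "r = real c / real (fdeg \<rat> l)"
  have "r \<ge> 0"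
    by (simp add: r_def)
  then have "max 0 (r * y) = r * max 0 y" for y
    by (auto simp: max_def mult_le_0_iff zero_le_mult_iff)
  then have "unit_height l x = r * (\<Sum>w\<in>arch_places l. max 0 (ln (w x)))"
    unfolding unit_height_def log_abs_def sum_distrib_left
    by (intro sum.cong refl) (simp add: deg r_def)
  then show ?thesis
    using sum W.card_pos by (simp add: r_def)
qed

lemma (in galois_tower) unit_height_nonneg: "unit_height l x \<ge> 0"
  unfolding unit_height_def by (intro sum_nonneg) simp

lemma (in stable_unit) unit_height_D:
  assumes deg: "\<And>w. w \<in> arch_places l \<Longrightarrow> loc_deg l w = c"
  shows "unit_height l D \<le> 2 * (real J - 1) * unit_height l \<alpha>"
proof -
  have "(\<Sum>\<sigma>\<in>G. max 0 (ln (cmod (\<sigma> D)))) \<le>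
      (\<Sum>\<sigma>\<in>G. \<Sum>\<psi>\<in>Psi. max 0 (of_int (lam \<psi>) * ln (cmod ((\<sigma> \<circ> \<psi>) \<alpha>))))"
  proof (intro sum_mono)
    fix \<sigma> assume \<sigma>: "\<sigma> \<in> G"
    have nz: "(\<sigma> \<circ> \<psi>) \<alpha> \<noteq> 0" if "\<psi> \<in> Psi" for \<psi>
    proof -
      have "\<sigma> \<circ> \<psi> \<in> G"
        using \<sigma> that Psi_subset by auto
      then show ?thesis
        using aut_hom(3)[OF _ lF \<alpha>_mem(1)] \<alpha>_mem(2) by blast
    qed
    have "ln (cmod (\<sigma> D)) = ln (\<Prod>\<psi>\<in>Psi. cmod ((\<sigma> \<circ> \<psi>) \<alpha>) powi lam \<psi>)"
      unfolding apply_D[OF \<sigma>] by (simp only: prod_norm[symmetric] norm_power_int)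
    also have "\<dots> = (\<Sum>\<psi>\<in>Psi. ln (cmod ((\<sigma> \<circ> \<psi>) \<alpha>) powi lam \<psi>))"
      using Psi_fin nz by (intro ln_prod) (auto simp: zero_less_power_int)
    also have "\<dots> = (\<Sum>\<psi>\<in>Psi. of_int (lam \<psi>) * ln (cmod ((\<sigma> \<circ> \<psi>) \<alpha>)))"
      using nz by (intro sum.cong refl) (simp add: ln_powr flip: powr_real_of_int')
    finally show "max 0 (ln (cmod (\<sigma> D))) \<le> (\<Sum>\<psi>\<in>Psi. max 0 (of_int (lam \<psi>) * ln (cmod ((\<sigma> \<circ> \<psi>) \<alpha>))))"
      using max_0_sum_le by metis
  qed
  also have "\<dots> = (\<Sum>\<psi>\<in>Psi. \<Sum>\<sigma>\<in>G. max 0 (of_int (lam \<psi>) * ln (cmod ((\<sigma> \<circ> \<psi>) \<alpha>))))"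
    by (rule sum.swap)
  \<comment> \<open>Right translation by \<psi> removes the conjugation, and the product formula
    turns a negative exponent into its absolute value.\<close>
  also have "\<dots> = (\<Sum>\<psi>\<in>Psi. \<bar>of_int (lam \<psi>)\<bar> * (\<Sum>\<sigma>\<in>G. max 0 (ln (cmod (\<sigma> \<alpha>)))))"
  proof (intro sum.cong refl)
    fix \<psi> assume "\<psi> \<in> Psi"
    then have \<psi>: "\<psi> \<in> G"
      using Psi_subset by blast
    have "(\<Sum>\<sigma>\<in>G. max 0 (of_int (lam \<psi>) * ln (cmod ((\<sigma> \<circ> \<psi>) \<alpha>)))) =
        (\<Sum>\<sigma>\<in>G. max 0 (of_int (lam \<psi>) * ln (cmod (\<sigma> \<alpha>))))"
      by (rule G.sum_right[OF \<psi>])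
    also have "\<dots> = \<bar>of_int (lam \<psi>)\<bar> * (\<Sum>\<sigma>\<in>G. max 0 (ln (cmod (\<sigma> \<alpha>))))"
      by (rule sum_max_0_mult[OF product_formula[OF gal_l unit]])
    finally show "(\<Sum>\<sigma>\<in>G. max 0 (of_int (lam \<psi>) * ln (cmod ((\<sigma> \<circ> \<psi>) \<alpha>)))) =
        \<bar>of_int (lam \<psi>)\<bar> * (\<Sum>\<sigma>\<in>G. max 0 (ln (cmod (\<sigma> \<alpha>))))" .
  qed
  also have "\<dots> = of_int (\<Sum>\<psi>\<in>Psi. \<bar>lam \<psi>\<bar>) * (\<Sum>\<sigma>\<in>G. max 0 (ln (cmod (\<sigma> \<alpha>))))"
    by (simp add: sum_distrib_right)
  also have "\<dots> = 2 * (real J - 1) * (\<Sum>\<sigma>\<in>G. max 0 (ln (cmod (\<sigma> \<alpha>))))"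
    by (simp add: sum_abs_lam)
  finally have le: "(\<Sum>\<sigma>\<in>G. max 0 (ln (cmod (\<sigma> D)))) \<le> 2 * (real J - 1) * (\<Sum>\<sigma>\<in>G. max 0 (ln (cmod (\<sigma> \<alpha>))))" .
  show ?thesis
    using mult_left_mono[OF le, of "real c / real (fdeg \<rat> l) / real (card W)"]
      unit_height_eq[OF deg, of D] unit_height_eq[OF deg, of \<alpha>] by (simp add: mult_ac)
qed

lemma (in stable_unit) unit_height_D_fdeg:
  assumes deg: "\<And>w. w \<in> arch_places l \<Longrightarrow> loc_deg l w = c"
  shows "unit_height l D \<le> 2 * (real (fdeg k l) - 1) * unit_height l \<alpha>"
proof -
  have "2 * (real J - 1) * unit_height l \<alpha> \<le> 2 * (real (fdeg k l) - 1) * unit_height l \<alpha>"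
    using J_le unit_height_nonneg by (intro mult_right_mono) simp_all
  then show ?thesis
    using unit_height_D[OF deg] by linarith
qed

section \<open>Reduction of the real and complex cases to stable units\<close>

lemma (in galois_tower) place_stab_totally_real:
  assumes "totally_real l" "w \<in> W" "x \<in> l"
  shows "w x = x"
proof -
  obtain s where s: "s \<in> G" "w0 = (\<lambda>x. cmod (s x))"
    using w0 by (auto simp: arch_places_def)
  have w: "w \<in> G" "\<And>y. cmod (s (inv w y)) = cmod (s y)"
    using assms(2) unfolding W_iff by (simp_all add: s(2))
  have wx: "w x \<in> l"
    using autD(2)[OF w(1) assms(3)] .
  have real: "s y \<in> \<real>" if "y \<in> l" for y
    using assms(1) s(1) that by (auto simp: totally_real_def)
  obtain a b where ab: "s x = of_real a" "s (w x) = of_real b"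
    using real[OF assms(3)] real[OF wx] by (auto elim!: Reals_cases)
  have "\<bar>a\<bar> = \<bar>b\<bar>"
    using w(2)[of "w x"] w(1) ab by simp
  \<comment> \<open>Equal absolute values leave a sign ambiguity between real numbers. Comparing 1 +
    x with its image as well rules out b = -a unless both are 0.\<close>
  moreover have "\<bar>1 + a\<bar> = \<bar>1 + b\<bar>"
  proof -
    have "s (1 + y) = 1 + s y" if "y \<in> l" for y
      using autD(3)[OF s(1) subfield_C_D(2)[OF lF] that] aut_hom(2)[OF s(1) lF] by simp
    moreover have "w (1 + x) = 1 + w x"
      using autD(3)[OF w(1) subfield_C_D(2)[OF lF] assms(3)] aut_hom(2)[OF w(1) lF] by simp
    moreover have "cmod (s (1 + x)) = cmod (s (w (1 + x)))"
      using w(2)[of "w (1 + x)"] w(1) by simp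
    ultimately have "cmod (1 + s x) = cmod (1 + s (w x))"
      using wx assms(3) by simp
    then have "cmod (of_real (1 + a)) = cmod (of_real (1 + b))"
      by (simp add: ab)
    then show ?thesis
      by (simp only: norm_of_real)
  qed
  ultimately have "s (w x) = s x"
    using ab by (auto simp: abs_if split: if_splits)
  then show ?thesis
    using G.bij_mem[OF s(1)] by (auto simp: bij_def inj_def)
qed

lemma (in galois_tower) special_minkowski_neg:
  assumes "special_minkowski l w0 \<beta>" "g \<in> G" "g \<notin> W"
  shows "ln (w0 (inv g \<beta>)) < 0"
proof -
  obtain s where s: "s \<in> G" "w0 = (\<lambda>x. cmod (s x))"
    using w0 by (auto simp: arch_places_def)
  define w where "w = place_act g w0"
  have "w = (\<lambda>x. cmod ((s \<circ> inv g) x))" "s \<circ> inv g \<in> G"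
    using s assms(2) by (auto simp: w_def place_act_def)
  then have "w \<in> arch_places l"
    unfolding arch_places_def by blast
  moreover have "w \<noteq> w0"
    using assms(2,3) by (auto simp: w_def place_stab_def)
  ultimately have "log_abs l w \<beta> < 0"
    using assms(1) by (auto simp: special_minkowski_def)
  \<comment> \<open>The normalising factor is nonnegative, and strictness of the inequality excludes
    that it is 0.\<close>
  then have "ln (w \<beta>) < 0"
    by (auto simp: log_abs_def mult_less_0_iff divide_less_0_iff)
  then show ?thesis
    by (simp add: w_def place_act_def)
qed

theorem theorem9p1:
  fixes l k :: "complex set" and w0 :: "complex \<Rightarrow> real"
    and Psi T S :: "cauto set" and Jsel :: "cauto \<Rightarrow> cauto set"
    and \<beta> :: complex and lam :: "cauto \<Rightarrow> int"
  assumes gal_l: "galois_over_Q l" and gal_k: "galois_over_Q k" and kl: "k \<subseteq> l"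
    and rk: "1 \<le> unit_rank k" "unit_rank k < unit_rank l"
    and w0: "w0 \<in> arch_places l"
    and Psi: "left_transversal (aut l \<rat>) (place_stab l w0) Psi"
    and T: "left_transversal (aut l \<rat>) (set_prod (place_stab l w0) (aut l k)) T"
    and S: "left_transversal (set_prod (place_stab l w0) (aut l k)) (place_stab l w0) S"
    and Jsel: "\<forall>\<tau>\<in>T. Jsel \<tau> \<subseteq> S \<and>
       card (Jsel \<tau>) = card (set_prod (place_stab l w0) (aut l k)) div card (place_stab l w0) - 1"
    and lam: "\<forall>g. lam g =
       (if g \<in> place_stab l w0
        then int (card (set_prod (place_stab l w0) (aut l k)) div card (place_stab l w0)) - 1
        else if g \<in> set_prod (place_stab l w0) (aut l k) then -1 else 0)"
    and beta: "special_minkowski l w0 \<beta>"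
  shows
   "(totally_real l \<longrightarrow>
       (\<forall>\<tau>\<in>T. \<forall>\<sigma>\<in>Jsel \<tau>. rel_unit l k ((\<tau> \<circ> \<sigma>) (Delta Psi \<beta> lam))) \<and>
       mult_indep {(\<tau>, \<sigma>). \<tau> \<in> T \<and> \<sigma> \<in> Jsel \<tau>} (\<lambda>(\<tau>, \<sigma>). (\<tau> \<circ> \<sigma>) (Delta Psi \<beta> lam)) \<and>
       unit_height l (Delta Psi \<beta> lam) \<le> 2 * (real (fdeg k l) - 1) * unit_height l \<beta>)
    \<and>
    (\<forall>\<rho>. totally_complex l \<and> place_stab l w0 = {id, \<rho>} \<and> \<rho> \<circ> \<rho> = id \<longrightarrow>
       (\<forall>\<tau>\<in>T. \<forall>\<sigma>\<in>Jsel \<tau>. rel_unit l k ((\<tau> \<circ> \<sigma>) (Delta Psi (\<beta> * \<rho> \<beta>) lam))) \<and>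
       mult_indep {(\<tau>, \<sigma>). \<tau> \<in> T \<and> \<sigma> \<in> Jsel \<tau>}
         (\<lambda>(\<tau>, \<sigma>). (\<tau> \<circ> \<sigma>) (Delta Psi (\<beta> * \<rho> \<beta>) lam)) \<and>
       unit_height l (Delta Psi (\<beta> * \<rho> \<beta>) lam) \<le> 4 * (real (fdeg k l) - 1) * unit_height l \<beta>)"
proof -
  interpret transversal_data l k w0 Psi T S Jsel lam
    by unfold_locales (fact gal_l gal_k kl w0 Psi T S Jsel lam)+
  have \<beta>: "\<beta> \<in> units_of_int l" "\<beta> \<in> l" "\<beta> \<noteq> 0"
    using beta by (auto simp: special_minkowski_def units_of_int_def)
  have pair: "\<tau> \<circ> \<sigma> \<in> G" if "\<tau> \<in> T" "\<sigma> \<in> Jsel \<tau>" for \<tau> \<sigma>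
  proof -
    have "\<tau> \<in> G" "\<sigma> \<in> P"
      using that T S Jsel unfolding left_transversal_def by blast+
    then show ?thesis
      using P_subset by auto
  qed
  show ?thesis
  proof (intro conjI impI allI ballI)
    assume real: "totally_real l"
    interpret stable_unit l k w0 Psi T S Jsel lam \<beta>
      by unfold_locales (use \<beta> place_stab_totally_real[OF real] in auto)
    have "loc_deg l w = 1" if "w \<in> arch_places l" for w
      using that real by (auto simp: loc_deg_def real_place_def arch_places_def totally_real_def)
    then show "unit_height l (Delta Psi \<beta> lam) \<le> 2 * (real (fdeg k l) - 1) * unit_height l \<beta>"
      by (rule unit_height_D_fdeg)
    show "rel_unit l k ((\<tau> \<circ> \<sigma>) (Delta Psi \<beta> lam))" if "\<tau> \<in> T" "\<sigma> \<in> Jsel \<tau>" for \<tau> \<sigma>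
      by (rule rel_unit_D[OF pair[OF that]])
    show "mult_indep {(\<tau>, \<sigma>). \<tau> \<in> T \<and> \<sigma> \<in> Jsel \<tau>} (\<lambda>(\<tau>, \<sigma>). (\<tau> \<circ> \<sigma>) (Delta Psi \<beta> lam))"
      using special_minkowski_neg[OF beta] by (intro mult_indep_D) (simp add: A_def)
  next
    fix \<rho>
    assume \<rho>: "totally_complex l \<and> W = {id, \<rho>} \<and> \<rho> \<circ> \<rho> = id"
    then have \<rho>W: "\<rho> \<in> W" and \<rho>G: "\<rho> \<in> G" and \<rho>\<rho>: "\<rho> (\<rho> x) = x" for x
      using W_subset by (auto simp: fun_eq_iff)
    have \<rho>\<beta>: "\<rho> \<beta> \<in> units_of_int l" "\<rho> \<beta> \<in> l" "\<rho> \<beta> \<noteq> 0"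
      using units_of_int_aut[OF \<rho>G lF \<beta>(1)] by (auto simp: units_of_int_def)
    have "\<rho> (\<beta> * \<rho> \<beta>) = \<beta> * \<rho> \<beta>"
      using autD(4)[OF \<rho>G \<beta>(2) \<rho>\<beta>(2)] by (simp add: \<rho>\<rho>)
    then have fixed: "w (\<beta> * \<rho> \<beta>) = \<beta> * \<rho> \<beta>" if "w \<in> W" for w
      using that \<rho> by auto
    interpret stable_unit l k w0 Psi T S Jsel lam "\<beta> * \<rho> \<beta>"
      by unfold_locales (use units_of_int_mult[OF lF \<beta>(1) \<rho>\<beta>(1)] fixed in auto)
    have deg: "loc_deg l w = 2" if "w \<in> arch_places l" for w
      using that \<rho> by (auto simp: loc_deg_def real_place_def totally_complex_def)
    \<comment> \<open>Subadditivity, with \<rho>(\<beta>) as high as \<beta> by right translation.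
      This doubles the constant 2 of the general bound to 4.\<close>
    have "unit_height l (\<beta> * \<rho> \<beta>) \<le> 2 * unit_height l \<beta>"
    proof -
      have "(\<Sum>\<sigma>\<in>G. max 0 (ln (cmod (\<sigma> (\<beta> * \<rho> \<beta>))))) \<le>
          (\<Sum>\<sigma>\<in>G. max 0 (ln (cmod (\<sigma> \<beta>))) + max 0 (ln (cmod ((\<sigma> \<circ> \<rho>) \<beta>))))"
      proof (intro sum_mono)
        fix \<sigma> assume \<sigma>: "\<sigma> \<in> G"
        have "ln (cmod (\<sigma> (\<beta> * \<rho> \<beta>))) = ln (cmod (\<sigma> \<beta>)) + ln (cmod ((\<sigma> \<circ> \<rho>) \<beta>))"
          using autD(4)[OF \<sigma> \<beta>(2) \<rho>\<beta>(2)] aut_hom(3)[OF \<sigma> lF] \<beta> \<rho>\<beta>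
          by (simp add: norm_mult ln_mult)
        then show "max 0 (ln (cmod (\<sigma> (\<beta> * \<rho> \<beta>)))) \<le>
            max 0 (ln (cmod (\<sigma> \<beta>))) + max 0 (ln (cmod ((\<sigma> \<circ> \<rho>) \<beta>)))"
          by linarith
      qed
      also have "\<dots> = 2 * (\<Sum>\<sigma>\<in>G. max 0 (ln (cmod (\<sigma> \<beta>))))"
        using G.sum_right[OF \<rho>G, of "\<lambda>\<sigma>. max 0 (ln (cmod (\<sigma> \<beta>)))"] by (simp add: sum.distrib)
      finally have le: "(\<Sum>\<sigma>\<in>G. max 0 (ln (cmod (\<sigma> (\<beta> * \<rho> \<beta>))))) \<le> 2 * (\<Sum>\<sigma>\<in>G. max 0 (ln (cmod (\<sigma> \<beta>))))" .
      show ?thesis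
        using mult_left_mono[OF le, of "real 2 / real (fdeg \<rat> l) / real (card W)"]
          unit_height_eq[OF deg, of "\<beta> * \<rho> \<beta>"] unit_height_eq[OF deg, of \<beta>] by (simp add: mult_ac)
    qed
    \<comment> \<open>The multiplier is nonnegative since 1 \<le> J \<le>
      \<open>fdeg k l\<close>.\<close>
    then have "2 * (real (fdeg k l) - 1) * unit_height l (\<beta> * \<rho> \<beta>) \<le>
        2 * (real (fdeg k l) - 1) * (2 * unit_height l \<beta>)"
      using J_le J(2) by (intro mult_left_mono) simp_all
    then show "unit_height l (Delta Psi (\<beta> * \<rho> \<beta>) lam) \<le> 4 * (real (fdeg k l) - 1) * unit_height l \<beta>"
      using unit_height_D_fdeg[OF deg] by (simp add: algebra_simps)
    show "rel_unit l k ((\<tau> \<circ> \<sigma>) (Delta Psi (\<beta> * \<rho> \<beta>) lam))" if "\<tau> \<in> T" "\<sigma> \<in> Jsel \<tau>" for \<tau> \<sigma>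
      by (rule rel_unit_D[OF pair[OF that]])
    \<comment> \<open>\<open>A g\<close> splits into the logarithms of \<beta> at the places g
      \<open>w0\<close> and (\<rho> \<circ> g) \<open>w0\<close>. As \<rho> lies in W, neither g nor
      \<rho> \<circ> g does, so both summands are negative.\<close>
    have "A g < 0" if g: "g \<in> G" "g \<notin> W" for g
    proof -
      have \<rho>g: "\<rho> \<circ> g \<in> G" "\<rho> \<circ> g \<notin> W"
      proof -
        show "\<rho> \<circ> g \<in> G"
          using \<rho>G g by simp
        show "\<rho> \<circ> g \<notin> W"
        proof
          assume "\<rho> \<circ> g \<in> W"
          then have "inv \<rho> \<circ> (\<rho> \<circ> g) \<in> W"
            by (rule W.comp_mem[OF W.inv_mem[OF \<rho>W]])
          then show False
            using g(2) \<rho>G by simp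
        qed
      qed
      have inv\<rho>: "inv \<rho> x = \<rho> x" for x
        using \<rho>\<rho>[of "inv \<rho> x"] \<rho>G by simp
      note ig = G.inv_mem[OF g(1)]
      have mem: "inv g \<beta> \<in> l" "inv g \<beta> \<noteq> 0" "inv g (\<rho> \<beta>) \<in> l" "inv g (\<rho> \<beta>) \<noteq> 0"
        using autD(2)[OF ig \<beta>(2)] autD(2)[OF ig \<rho>\<beta>(2)] aut_hom(3)[OF ig lF] \<beta> \<rho>\<beta> by auto
      have "A g = ln (w0 (inv g \<beta> * inv g (\<rho> \<beta>)))"
        unfolding A_def by (simp add: autD(4)[OF ig \<beta>(2) \<rho>\<beta>(2)])
      also have "\<dots> = ln (w0 (inv g \<beta>)) + ln (w0 (inv g (\<rho> \<beta>)))"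
        using w0_pos[OF mem(1,2)] w0_pos[OF mem(3,4)] by (simp add: w0_hom mem ln_mult)
      also have "inv g (\<rho> \<beta>) = inv (\<rho> \<circ> g) \<beta>"
        using \<rho>G g(1) by (simp add: G.inv_comp inv\<rho>)
      finally show ?thesis
        using special_minkowski_neg[OF beta g] special_minkowski_neg[OF beta \<rho>g] by simp
    qed
    then show "mult_indep {(\<tau>, \<sigma>). \<tau> \<in> T \<and> \<sigma> \<in> Jsel \<tau>}
        (\<lambda>(\<tau>, \<sigma>). (\<tau> \<circ> \<sigma>) (Delta Psi (\<beta> * \<rho> \<beta>) lam))"
      by (rule mult_indep_D)
  qed
qed

end
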